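(* Let $1\le r<n$ be integers and let $f:\mathbb{R}^{n\times n}\to\mathbb{R}$ be twice differentiable, satisfying Assumptions A1 (with constants $L\ge\mu>0$) and A2 (with unconstrained minimizer $\mathbf{X}_*$) of the context, and assume $L/\mu<3$. For an initialization $\mathbf{X}^{(0)}$ of rank at most $r$ and a step size $\eta>0$ let $\mathbf{X}^{(k+1)}=\mathcal{P}_r\big(\mathbf{X}^{(k)}-\eta\nabla f(\mathbf{X}^{(k)})\big)$, $k\ge0$, be the iterates of projected gradient descent (ProjGD). (a) For every step size with $$\frac{L^2-\mu^2}{2L\mu(L+\mu)}<\eta<\frac1L ,$$ ProjGD converges linearly to $\mathbf{X}_*$. (b) Let $\kappa_0=\frac{L-\mu}{L+\mu}$ and let $\epsilon>0$ be such that $\hat\kappa_0=\sqrt{\kappa_0^2+2\epsilon-2\epsilon^2}$ is a positive real number with $\hat\kappa_0<1/2$. If $\eta$ is chosen such that $\eta_0=\frac{(L+\mu)\eta}{2}$ satisfies $$\frac{1}{1/\hat\kappa_0-\hat\kappa_0}<\eta_0<\frac{1}{1+\kappa_0},$$ then for every $k\ge0$ (with $f(\mathbf{X}^{(k)})\neq f(\mathbf{X}_* )$) $$\frac{f(\mathbf{X}^{(k+1)})-f(\mathbf{X}_* )}{f(\mathbf{X}^{(k)})-f(\mathbf{X}_* )}\le 1-\Big(\frac{1}{(1+\kappa_0)\eta_0}-1\Big)\min\Bigg(\frac{\eta_0}{10},\ \frac{2\epsilon\eta_0}{3},\ \frac{1}{2\sqrt r}\Big(\eta_0-\frac{\hat\kappa_0}{1-\hat\kappa_0^2}\Big)\Bigg)^2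 .$$
   Context: $\|\cdot\|_F$ and $\langle\cdot,\cdot\rangle$ are the Frobenius norm and inner product. $\mathcal{P}_r(\mathbf{Y})$ denotes a nearest matrix to $\mathbf{Y}$ of rank at most $r$ in Frobenius norm (truncated SVD keeping the top $r$ singular triples; any choice in case of ties). Assumption A1 (rank-$2r$ restricted smoothness and strong convexity): for all $\mathbf{X},\mathbf{X}',\mathbf{E}\in\mathbb{R}^{n\times n}$ of rank at most $2r$, $\|\nabla f(\mathbf{X})-\nabla f(\mathbf{X}')\|_F\le L\|\mathbf{X}-\mathbf{X}'\|_F$ and $\langle\nabla^2 f(\mathbf{X})[\mathbf{E}],\mathbf{E}\rangle\ge\mu\|\mathbf{E}\|_F^2$. Assumption A2: $f$ has a minimizer $\mathbf{X}_*=\arg\min_{\mathbf{X}\in\mathbb{R}^{n\times n}}f(\mathbf{X})$ over all of $\mathbb{R}^{n\times n}$, and $\mathrm{rank}(\mathbf{X}_* )=r_*\le r$.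
   Formalization: In (b) the extra condition ε < 1/2 is imposed: ε and 1−ε give the same κ̂₀, and for ε close to 1 the stated bound fails (e.g. n=2, r=1, L=μ=1, f(X)=½‖X−diag(0,1)‖², ε=1−10⁻⁶, η=0.01, X⁽⁰⁾=diag(0.0102,0)). *)

theory Defs
  imports "HOL-Analysis.Analysis"
begin

text \<open>
  On \<^typ>\<open>real^'n^'n\<close> the library's \<^const>\<open>norm\<close> and \<^const>\<open>inner\<close> are the Frobenius norm
  and the Frobenius inner product.
\<close>

definition gradient :: "('a::real_inner \<Rightarrow> real) \<Rightarrow> 'a \<Rightarrow> 'a" where
  "gradient f x = (THE D. GDERIV f x :> D)"

lemma GDERIV_gradient:
  fixes f :: "'a::euclidean_space \<Rightarrow> real"
  assumes "f differentiable (at x)"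
  shows "GDERIV f x :> gradient f x"
proof -
  obtain f' where f': "(f has_derivative f') (at x)"
    using assms by (auto simp: differentiable_def)
  define D where "D = (\<Sum>b\<in>Basis. f' b *\<^sub>R b)"
  interpret linear f'
    using f' by (rule has_derivative_linear)
  have f'_eq: "f' = (\<lambda>h. inner h D)"
  proof
    fix h
    have "f' h = f' (\<Sum>b\<in>Basis. inner h b *\<^sub>R b)"
      by (simp add: euclidean_representation)
    also have "\<dots> = inner h D"
      by (simp add: sum scale D_def inner_sum_right mult.commute)
    finally show "f' h = inner h D" .
  qed
  have D: "GDERIV f x :> D"
    using f' by (simp add: gderiv_def f'_eq)
  show ?thesis
    unfolding gradient_def
  proof (rule theI)
    show "GDERIV f x :> D" by (rule D)
    fix D' assume "GDERIV f x :> D'"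
    with D have "(\<lambda>h. inner h D') = (\<lambda>h. inner h D)"
      by (auto simp: gderiv_def dest: has_derivative_unique)
    then have "inner h D' = inner h D" for h
      by metis
    then show "D' = D"
      by (metis vector_eq_ldot)
  qed
qed

text \<open>The Hessian \<open>\<nabla>\<^sup>2f(x)[e]\<close> is the derivative of the gradient map at \<open>x\<close> applied to \<open>e\<close>.\<close>

definition hessian :: "('a::real_inner \<Rightarrow> real) \<Rightarrow> 'a \<Rightarrow> 'a \<Rightarrow> 'a" where
  "hessian f x = frechet_derivative (gradient f) (at x)"

definition twice_differentiable :: "('a::real_inner \<Rightarrow> real) \<Rightarrow> bool" where
  "twice_differentiable f \<longleftrightarrow>
     (\<forall>x. f differentiable (at x)) \<and> (\<forall>x. gradient f differentiable (at x))"

definition restricted_smooth_strongly_convex ::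
    "nat \<Rightarrow> real \<Rightarrow> real \<Rightarrow> (real^'n^'n \<Rightarrow> real) \<Rightarrow> bool" where
  "restricted_smooth_strongly_convex r L \<mu> f \<longleftrightarrow>
     (\<forall>X X' E. rank X \<le> 2 * r \<longrightarrow> rank X' \<le> 2 * r \<longrightarrow> rank E \<le> 2 * r \<longrightarrow>
        norm (gradient f X - gradient f X') \<le> L * norm (X - X') \<and>
        inner (hessian f X E) E \<ge> \<mu> * (norm E)\<^sup>2)"

text \<open>
  Nearest matrices of rank at most \<open>r\<close> need not be unique, so the projection is a relation
  between \<open>Y\<close> and a nearest matrix \<open>Z\<close>, and every way of breaking ties is an admissible run.
\<close>

definition is_rank_projection :: "nat \<Rightarrow> real^'n^'n \<Rightarrow> real^'n^'n \<Rightarrow> bool" where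
  "is_rank_projection r Y Z \<longleftrightarrow> is_arg_min (\<lambda>W. norm (Y - W)) (\<lambda>W. rank W \<le> r) Z"

definition projgd_iterates ::
    "(real^'n^'n \<Rightarrow> real) \<Rightarrow> nat \<Rightarrow> real \<Rightarrow> (nat \<Rightarrow> real^'n^'n) \<Rightarrow> bool" where
  "projgd_iterates f r \<eta> X \<longleftrightarrow>
     rank (X 0) \<le> r \<and>
     (\<forall>k. is_rank_projection r (X k - \<eta> *\<^sub>R gradient f (X k)) (X (Suc k)))"

definition converges_linearly ::
    "real \<Rightarrow> (nat \<Rightarrow> 'a::real_normed_vector) \<Rightarrow> 'a \<Rightarrow> bool" where
  "converges_linearly \<rho> X x \<longleftrightarrow>
     0 \<le> \<rho> \<and> \<rho> < 1 \<and> (\<exists>C. \<forall>k. norm (X k - x) \<le> C * \<rho> ^ k)"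

end

theory Submission
  imports Defs
begin

text \<open>
  Minimality of the projection gives the usual descent
  \<open>f(X\<^sup>+) \<le> f(X) - (1/(2\<eta>) - L/2) \<parallel>X\<^sup>+ - X\<parallel>\<^sup>2\<close>, so it suffices to show that a step is never
  short: \<open>\<parallel>X\<^sup>+ - X\<parallel> \<ge> m \<parallel>\<Delta>\<parallel>\<close> with \<open>\<Delta> = X - X\<^sub>*\<close>. Let \<open>P\<close> project onto the sum of the column spaces
  of \<open>X\<close> and \<open>X\<^sub>*\<close>. All matrices \<open>P A\<close> have rank at most \<open>2r\<close>, so co-coercivity
  of the gradient on this subspace gives \<open>\<parallel>2/(L+\<mu>) P \<nabla>f(X) - \<Delta>\<parallel> \<le> \<kappa>\<^sub>0 \<parallel>\<Delta>\<parallel>\<close>. If the step were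
  short, the residual of the projection would be nearly normal to the rank-\<open>r\<close> matrices
  at \<open>X\<close> and its spectral norm nearly at most \<open>\<sigma>\<^sub>r(X)\<close>. Up to small errors \<open>\<Delta>\<close> is then within
  \<open>\<kappa> \<parallel>\<Delta>\<parallel>\<close> of such a normal matrix; completing the square, \<open>X\<^sub>*\<close> lies within \<open>\<kappa> \<parallel>M\<parallel>\<close> of \<open>X - M\<close>
  with \<open>M\<close> normal of spectral norm less than \<open>\<sigma>\<^sub>r(X)/\<kappa>\<close>. This contradicts a bound of Eckart-Young
  type. Part (a) follows from (b) by letting \<open>\<epsilon>\<close> tend to \<open>0\<close>.
\<close>

subsection \<open>The Frobenius norm and orthogonal projectors\<close>

text \<open>Keeps products with a transposed matrix in the form \<open>transpose A *v x\<close>, in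
  which the singular value bounds below are stated.\<close>

declare transpose_matrix_vector [simp del]

lemma inner_transpose_transpose:
  fixes A B :: "real^'n^'m"
  shows "inner (transpose A) (transpose B) = inner A B"
  unfolding inner_vec_def transpose_def by (simp, rule sum.swap)

lemma norm_transpose_matrix:
  fixes A :: "real^'n^'m"
  shows "norm (transpose A) = norm A"
  by (simp add: norm_eq_sqrt_inner inner_transpose_transpose)

lemma inner_matrix_mult_left:
  fixes A :: "real^'n^'m" and B :: "real^'p^'n" and C :: "real^'p^'m"
  shows "inner (A ** B) C = inner B (transpose A ** C)"
proof -
  have "inner (A ** B) C = (\<Sum>i\<in>UNIV. \<Sum>j\<in>UNIV. \<Sum>k\<in>UNIV. A$i$k * B$k$j * C$i$j)"
    by (simp add: inner_vec_def matrix_matrix_mult_def sum_distrib_right)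
  also have "\<dots> = (\<Sum>i\<in>UNIV. \<Sum>k\<in>UNIV. \<Sum>j\<in>UNIV. A$i$k * B$k$j * C$i$j)"
    by (rule sum.cong [OF refl], rule sum.swap)
  also have "\<dots> = (\<Sum>k\<in>UNIV. \<Sum>i\<in>UNIV. \<Sum>j\<in>UNIV. A$i$k * B$k$j * C$i$j)"
    by (rule sum.swap)
  also have "\<dots> = (\<Sum>k\<in>UNIV. \<Sum>j\<in>UNIV. \<Sum>i\<in>UNIV. A$i$k * B$k$j * C$i$j)"
    by (rule sum.cong [OF refl], rule sum.swap)
  also have "\<dots> = inner B (transpose A ** C)"
    by (simp add: inner_vec_def matrix_matrix_mult_def transpose_def sum_distrib_left mult_ac)
  finally show ?thesis .
qed

lemma inner_matrix_mult_right:
  fixes A :: "real^'n^'m" and B :: "real^'p^'n" and C :: "real^'p^'m"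
  shows "inner (A ** B) C = inner A (C ** transpose B)"
proof -
  have "inner (A ** B) C = inner (transpose B ** transpose A) (transpose C)"
    by (metis inner_transpose_transpose matrix_transpose_mul)
  also have "\<dots> = inner (transpose A) (B ** transpose C)"
    by (simp add: inner_matrix_mult_left)
  also have "\<dots> = inner A (C ** transpose B)"
    by (metis inner_transpose_transpose matrix_transpose_mul transpose_transpose)
  finally show ?thesis .
qed

lemma norm_sq_columns:
  fixes A :: "real^'n^'m"
  shows "(norm A)\<^sup>2 = (\<Sum>j\<in>UNIV. (norm (column j A))\<^sup>2)"
proof -
  have "(norm A)\<^sup>2 = inner (transpose A) (transpose A)"
    by (simp add: power2_norm_eq_inner inner_transpose_transpose)
  also have "\<dots> = (\<Sum>j\<in>UNIV. (norm (column j A))\<^sup>2)"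
    by (subst inner_vec_def) (simp add: power2_norm_eq_inner column_def transpose_def)
  finally show ?thesis .
qed

lemma column_matrix_mult: "column j (A ** B) = A *v column j B"
  by (simp add: column_def matrix_matrix_mult_def matrix_vector_mult_def vec_eq_iff)

text \<open>The squared Frobenius norm adds up over columns, and each column of
  \<open>A ** C\<close> is \<open>A\<close> applied to a column of \<open>C\<close>. Comparisons of
  singular values are written below as inequalities between vector norms; this turns them into
  Frobenius bounds.\<close>

lemma norm_matrix_mult_mono:
  fixes A :: "real^'n^'m" and B :: "real^'n^'k" and C :: "real^'p^'n"
  assumes "\<And>u. norm (A *v u) \<le> norm (B *v u)"
  shows "norm (A ** C) \<le> norm (B ** C)"
proof -
  have "(norm (A ** C))\<^sup>2 \<le> (norm (B ** C))\<^sup>2"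
    unfolding norm_sq_columns column_matrix_mult
    by (intro sum_mono power_mono assms norm_ge_zero)
  then show ?thesis by (rule power2_le_imp_le) simp
qed

lemma norm_matrix_vector_mult_le:
  fixes A :: "real^'n^'m"
  shows "norm (A *v v) \<le> norm A * norm v"
proof -
  have "(norm (A *v v))\<^sup>2 = (\<Sum>i\<in>UNIV. (inner (A$i) v)\<^sup>2)"
    unfolding power2_norm_eq_inner inner_vec_def [of "A *v v"]
    by (simp add: matrix_vector_mul_component power2_eq_square)
  also have "\<dots> \<le> (\<Sum>i\<in>UNIV. inner (A$i) (A$i) * inner v v)"
    by (intro sum_mono Cauchy_Schwarz_ineq)
  also have "\<dots> = (norm A * norm v)\<^sup>2"
    by (simp add: power_mult_distrib power2_norm_eq_inner inner_vec_def [of A] sum_distrib_right)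
  finally show ?thesis by (rule power2_le_imp_le) simp
qed

lemma scaleR_matrix_mult:
  fixes A :: "real^'n^'m" and B :: "real^'p^'n"
  shows "(c *\<^sub>R A) ** B = c *\<^sub>R (A ** B)" "A ** (c *\<^sub>R B) = c *\<^sub>R (A ** B)"
  by (simp_all add: matrix_matrix_mult_def vec_eq_iff sum_distrib_left mult_ac)

lemma matrix_mult_diff_distrib:
  fixes A A' :: "real^'n^'m" and B B' :: "real^'p^'n"
  shows "(A - A') ** B = A ** B - A' ** B" "A ** (B - B') = A ** B - A ** B'"
  by (simp_all add: matrix_matrix_mult_def vec_eq_iff algebra_simps sum_subtractf)

lemma matrix_mult_add_distrib:
  fixes A A' :: "real^'n^'m" and B B' :: "real^'p^'n"
  shows "(A + A') ** B = A ** B + A' ** B" "A ** (B + B') = A ** B + A ** B'"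
  by (simp_all add: matrix_matrix_mult_def vec_eq_iff algebra_simps sum.distrib)

lemma matrix_mult_zero [simp]:
  fixes A :: "real^'n^'m" 
  shows "(0 :: real^'m^'l) ** A = 0" "A ** (0 :: real^'k^'n) = 0"
  by (simp_all add: matrix_matrix_mult_def vec_eq_iff)

lemma transpose_diff:
  fixes A B :: "real^'n^'m"
  shows "transpose (A - B) = transpose A - transpose B"
  by (simp add: transpose_def vec_eq_iff)

lemma transpose_uminus:
  fixes A :: "real^'n^'m"
  shows "transpose (- A) = - transpose A"
  by (simp add: transpose_def vec_eq_iff)

lemma transpose_zero [simp]: "transpose (0 :: real^'n^'m) = 0"
  by (simp add: transpose_def vec_eq_iff)

section \<open>Orthogonal projectors and dimension counts\<close>

definition orthogonal_projector :: "real^'n^'n \<Rightarrow> bool" where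
  "orthogonal_projector P \<longleftrightarrow> transpose P = P \<and> P ** P = P"

lemma orthogonal_projector_complement:
  assumes "orthogonal_projector P"
  shows "orthogonal_projector (mat 1 - P)"
  using assms by (simp add: orthogonal_projector_def transpose_diff matrix_mult_diff_distrib)

lemma orthogonal_projector_pythagoras:
  fixes A :: "real^'p^'n"
  assumes "orthogonal_projector P"
  shows "(norm ((mat 1 - P) ** A))\<^sup>2 + (norm (P ** A))\<^sup>2 = (norm A)\<^sup>2"
proof -
  have *: "inner (P ** A) (P ** A) = inner A (P ** A)"
    using assms by (simp add: inner_matrix_mult_left matrix_mul_assoc orthogonal_projector_def)
  show ?thesis
    unfolding power2_norm_eq_inner
    by (simp add: matrix_mult_diff_distrib inner_diff_left inner_diff_right * inner_commute)
qed

lemma orthogonal_projector_pythagoras_vec: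
  fixes v :: "real^'n"
  assumes "orthogonal_projector P"
  shows "(norm ((mat 1 - P) *v v))\<^sup>2 + (norm (P *v v))\<^sup>2 = (norm v)\<^sup>2"
proof -
  have "inner (P *v v) (P *v v) = inner v (P *v v)"
    using assms
    by (metis dot_lmul_matrix inner_commute matrix_vector_mul_assoc orthogonal_projector_def
        transpose_matrix_vector)
  then show ?thesis
    unfolding power2_norm_eq_inner
    by (simp add: matrix_vector_mult_diff_rdistrib inner_diff_left inner_diff_right inner_commute)
qed

lemma norm_orthogonal_projector_le:
  assumes "orthogonal_projector P"
  shows "norm (P ** A) \<le> norm A" "norm ((mat 1 - P) ** A) \<le> norm A"
    "norm (P *v v) \<le> norm v" "norm ((mat 1 - P) *v v) \<le> norm v"
proof -
  have le: "a \<le> c \<and> b \<le> c" if "a\<^sup>2 + b\<^sup>2 = c\<^sup>2" "0 \<le> c" for a b c :: real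
    using that zero_le_power2 [of a] zero_le_power2 [of b]
    by (intro conjI power2_le_imp_le [of a c] power2_le_imp_le [of b c]) linarith+
  show "norm (P ** A) \<le> norm A" "norm ((mat 1 - P) ** A) \<le> norm A"
    "norm (P *v v) \<le> norm v" "norm ((mat 1 - P) *v v) \<le> norm v"
    using le [OF orthogonal_projector_pythagoras [OF assms, of A]]
      le [OF orthogonal_projector_pythagoras_vec [OF assms, of v]] by auto
qed

lemma norm_orthogonal_projector_le_right:
  assumes "orthogonal_projector P"
  shows "norm (A ** P) \<le> norm A" "norm (A ** (mat 1 - P)) \<le> norm A"
proof -
  have *: "norm (A ** Q) = norm (Q ** transpose A)" if "orthogonal_projector Q" for Q
    using that norm_transpose_matrix [of "A ** Q"]
    by (simp add: matrix_transpose_mul orthogonal_projector_def)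
  show "norm (A ** P) \<le> norm A" "norm (A ** (mat 1 - P)) \<le> norm A"
    using norm_orthogonal_projector_le(1,2) [OF assms, of "transpose A"] assms
    by (simp_all add: * norm_transpose_matrix orthogonal_projector_complement)
qed

lemma norm_mult_orthogonal_projectors_commute:
  assumes "orthogonal_projector P" "orthogonal_projector Q"
  shows "norm (P ** Q) = norm (Q ** P)"
  using assms norm_transpose_matrix [of "P ** Q"]
  by (simp add: matrix_transpose_mul orthogonal_projector_def)

text \<open>\<open>P\<close> sums \<open>b b^T\<close> over an orthonormal basis of
  \<open>S\<close>. Its squared Frobenius norm is its trace, so comparing dimensions becomes
  comparing norms, to which Pythagoras applies.\<close>

lemma orthogonal_projector_onto_subspace:
  fixes S :: "(real^'n) set"
  assumes "subspace S"
  obtains P where "orthogonal_projector P" "range ((*v) P) = S" "(norm P)\<^sup>2 = real (dim S)"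
proof -
  obtain B where B: "B \<subseteq> S" "pairwise orthogonal B" "\<And>x. x \<in> B \<Longrightarrow> norm x = 1"
    "independent B" "card B = dim S" "span B = S"
    using orthonormal_basis_subspace [OF assms] by metis
  have fin: "finite B" using B(4) by (rule independent_imp_finite)
  have orth: "inner b c = (if b = c then 1 else 0)" if "b \<in> B" "c \<in> B" for b c
    using that B(2,3) by (auto simp: pairwise_def orthogonal_def norm_eq_1)
  define P :: "real^'n^'n" where "P = (\<chi> i j. \<Sum>b\<in>B. b$i * b$j)"
  have Pv: "P *v x = (\<Sum>b\<in>B. inner b x *\<^sub>R b)" for x
    by (simp add: P_def matrix_vector_mult_def inner_vec_def vec_eq_iff sum_distrib_right
        sum_distrib_left mult_ac) (intro allI sum.swap)
  have Pb: "P *v b = b" if "b \<in> B" for b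
    using that fin by (simp add: Pv orth if_distrib [of "\<lambda>t. t *\<^sub>R _"] sum.delta cong: if_cong)
  have in_S: "P *v x \<in> S" for x
    unfolding Pv using B(1) assms by (auto intro!: subspace_sum subspace_scale)
  have fixed: "P *v x = x" if "x \<in> S" for x
  proof -
    have "x \<in> span B" using that B(6) by simp
    then show ?thesis
      by (induction rule: span_induct_alt) (auto simp: algebra_simps Pb)
  qed
  have sym: "transpose P = P"
    by (simp add: P_def transpose_def vec_eq_iff mult.commute)
  have idem: "P ** P = P"
    by (simp add: matrix_eq fixed in_S flip: matrix_vector_mul_assoc)
  have rng: "range ((*v) P) = S"
    using in_S fixed by (metis image_subset_iff rangeI subsetI subset_antisym)
  \<comment> \<open>By symmetry and idempotence \<open>inner P P\<close> is the trace
    \<open>inner P (mat 1)\<close>.\<close>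
  have "(norm P)\<^sup>2 = inner P (transpose P ** mat 1)"
    using inner_matrix_mult_left [of P P "mat 1"] inner_matrix_mult_left [of P "mat 1" P] idem sym
    by (simp add: power2_norm_eq_inner)
  also have "\<dots> = inner P (mat 1)"
    using inner_matrix_mult_left [of P P "mat 1"] by (simp add: idem)
  also have "\<dots> = (\<Sum>i\<in>UNIV. \<Sum>b\<in>B. b$i * b$i)"
    by (simp add: inner_vec_def mat_def P_def if_distrib [of "\<lambda>t. _ * t"] sum.delta cong: if_cong)
  also have "\<dots> = (\<Sum>b\<in>B. inner b b)"
    by (subst sum.swap) (simp add: inner_vec_def)
  also have "\<dots> = real (dim S)"
    using B(5) by (simp add: orth)
  finally show ?thesis using that sym idem rng by (simp add: orthogonal_projector_def)
qed

lemma orthogonal_projector_fixes_range: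
  assumes "orthogonal_projector P" "x \<in> range ((*v) P)"
  shows "P *v x = x"
  using assms by (auto simp: orthogonal_projector_def matrix_vector_mul_assoc)

lemma orthogonal_projector_mult_id:
  assumes "orthogonal_projector P" "range ((*v) A) \<subseteq> range ((*v) P)"
  shows "P ** A = A"
  unfolding matrix_eq
  using assms(2) orthogonal_projector_fixes_range [OF assms(1)]
  by (metis matrix_vector_mul_assoc rangeI subsetD)

lemma subspace_range_matrix: "subspace (range ((*v) (A :: real^'n^'m)))"
  by (simp add: linear_subspace_image)

lemma orthogonal_projector_onto_range:
  fixes A :: "real^'n^'n"
  obtains P where "orthogonal_projector P" "range ((*v) P) = range ((*v) A)"
    "P ** A = A" "(norm P)\<^sup>2 = real (rank A)"
proof -
  obtain P where "orthogonal_projector P" "range ((*v) P) = range ((*v) A)"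
    "(norm P)\<^sup>2 = real (dim (range ((*v) A)))"
    using orthogonal_projector_onto_subspace [OF subspace_range_matrix [of A]] .
  then show ?thesis
    by (intro that [of P]) (auto simp: orthogonal_projector_mult_id rank_dim_range)
qed

text \<open>The range of \<open>P\<close> is the sum of the two column spaces. The matrices fixed by
  \<open>P\<close> form a linear space of bounded rank, which is where the restricted assumptions on
  \<open>f\<close> can be used.\<close>

lemma orthogonal_projector_onto_sum:
  fixes A B :: "real^'n^'n"
  obtains P where "orthogonal_projector P" "P ** A = A" "P ** B = B"
    "rank P \<le> rank A + rank B" "(norm P)\<^sup>2 \<le> real (rank A + rank B)"
    "range ((*v) A) \<subseteq> range ((*v) P)"
proof -
  let ?S = "range ((*v) A)" and ?T = "range ((*v) B)"
  define U where "U = {x + y |x y. x \<in> ?S \<and> y \<in> ?T}"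
  have sub: "subspace U"
    unfolding U_def by (intro subspace_sums subspace_range_matrix)
  have "dim U + dim (?S \<inter> ?T) = dim ?S + dim ?T"
    unfolding U_def by (intro dim_sums_Int subspace_range_matrix)
  then have dimU: "dim U \<le> rank A + rank B"
    by (simp add: rank_dim_range)
  have SU: "?S \<subseteq> U" "?T \<subseteq> U"
    unfolding U_def
    using subspace_0 [OF subspace_range_matrix [of A]] subspace_0 [OF subspace_range_matrix [of B]]
    by (blast intro: add.left_neutral [symmetric] add.right_neutral [symmetric])+
  obtain P where P: "orthogonal_projector P" "range ((*v) P) = U" "(norm P)\<^sup>2 = real (dim U)"
    using orthogonal_projector_onto_subspace [OF sub] .
  show ?thesis
  proof (rule that [OF P(1)])
    show "P ** A = A" "P ** B = B"
      using P SU by (auto intro: orthogonal_projector_mult_id)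
    show "rank P \<le> rank A + rank B" "(norm P)\<^sup>2 \<le> real (rank A + rank B)"
      using P dimU by (simp_all add: rank_dim_range)
    show "?S \<subseteq> range ((*v) P)" using P SU by simp
  qed
qed

subsection \<open>Nearest matrices of bounded rank\<close>

definition outer_product :: "real^'m \<Rightarrow> real^'n \<Rightarrow> real^'n^'m" where
  "outer_product x y = (\<chi> i j. x$i * y$j)"

lemma inner_outer_product: "inner A (outer_product x y) = inner x (A *v y)"
  by (simp add: outer_product_def inner_vec_def matrix_vector_mult_def sum_distrib_left mult_ac)

lemma outer_product_mult_vec: "outer_product x y *v v = inner y v *\<^sub>R x"
  by (simp add: outer_product_def inner_vec_def matrix_vector_mult_def vec_eq_iff
      sum_distrib_left sum_distrib_right mult_ac)

lemma outer_product_matrix_mult: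
  fixes A :: "real^'p^'n"
  shows "outer_product x y ** A = outer_product x (transpose A *v y)"
  by (simp add: outer_product_def matrix_matrix_mult_def matrix_vector_mult_def vec_eq_iff
      transpose_def sum_distrib_left mult_ac)

lemma norm_outer_product: "norm (outer_product x y) = norm x * norm y"
proof -
  have "inner (outer_product x y) (outer_product x y) = inner x x * inner y y"
    by (simp add: inner_outer_product outer_product_mult_vec)
  then show ?thesis by (simp add: norm_eq_sqrt_inner real_sqrt_mult)
qed

lemma rank_outer_product_le: "rank (outer_product x y) \<le> 1"
proof -
  have "range ((*v) (outer_product x y)) \<subseteq> span {x}"
    by (auto simp: outer_product_mult_vec intro: span_scale span_base)
  then have "rank (outer_product x y) \<le> dim {x}"
    by (metis rank_dim_range dim_subset dim_span)
  also have "\<dots> \<le> 1" by (metis dim_le_card' finite.emptyI finite.insertI card_1_singleton_iff One_nat_def)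
  finally show ?thesis .
qed

lemma rank_add_le:
  fixes A B :: "real^'n^'n"
  shows "rank (A + B) \<le> rank A + rank B"
proof -
  obtain P where P: "P ** A = A" "P ** B = B" "rank P \<le> rank A + rank B"
    using orthogonal_projector_onto_sum [of A B] by metis
  then have "P ** (A + B) = A + B" by (simp add: matrix_mult_add_distrib)
  then show ?thesis using P(3) rank_mul_le_left [of P "A + B"] by simp
qed

lemma rank_scaleR_le: "rank (c *\<^sub>R (A :: real^'n^'n)) \<le> rank A"
  using rank_mul_le_left [of A "c *\<^sub>R mat 1"] by (simp add: scaleR_matrix_mult)

text \<open>The new range stays inside the range of \<open>Z\<close> but is orthogonal to
  \<open>u\<close>, which lies in the old range; the inclusion is therefore proper.\<close>

lemma rank_deflation_less:
  fixes Z :: "real^'n^'n"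
  assumes "u \<in> range ((*v) Z)" "norm u = 1"
  shows "rank (Z - outer_product u u ** Z) < rank Z"
proof -
  let ?S = "range ((*v) Z)" and ?T = "range ((*v) (Z - outer_product u u ** Z))"
  have eq: "(Z - outer_product u u ** Z) *v v = Z *v v - inner u (Z *v v) *\<^sub>R u" for v
    by (simp add: matrix_vector_mult_diff_rdistrib outer_product_mult_vec
        flip: matrix_vector_mul_assoc)
  have "?T \<subseteq> ?S"
  proof
    fix v assume "v \<in> ?T"
    then obtain w where v: "v = (Z - outer_product u u ** Z) *v w" by auto
    show "v \<in> ?S"
      unfolding v eq using assms(1)
      by (intro subspace_diff subspace_scale subspace_range_matrix rangeI)
  qed
  moreover have "inner u v = 0" if "v \<in> ?T" for v
    using that assms(2) by (auto simp: eq inner_diff_right norm_eq_1)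
  then have "u \<notin> ?T" using assms(2) by force
  ultimately have "?T \<subset> ?S" using assms(1) by blast
  then show ?thesis
    by (simp add: rank_dim_range) (metis dim_psubset span_eq_iff subspace_range_matrix)
qed

section \<open>Optimality conditions for the rank projection\<close>

lemma inner_zero_if_norm_minimal:
  fixes R V :: "'a::real_inner"
  assumes "\<And>t. norm R \<le> norm (R + t *\<^sub>R V)"
  shows "inner R V = 0"
proof (cases "V = 0")
  case False
  \<comment> \<open>The minimizer of the quadratic \<open>(norm (R + t *\<^sub>R V))\<^sup>2\<close>
    in \<open>t\<close>.\<close>
  define t where "t = - inner R V / inner V V"
  have "(norm R)\<^sup>2 \<le> (norm (R + t *\<^sub>R V))\<^sup>2"
    by (intro power_mono assms) simp
  then have "0 \<le> 2 * t * inner R V + t * t * inner V V"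
    by (simp add: power2_norm_eq_inner inner_add_left inner_add_right inner_commute)
  also have "\<dots> = - (inner R V)\<^sup>2 / inner V V"
    using False by (simp add: t_def field_simps power2_eq_square)
  finally show ?thesis using False
    by (simp add: divide_le_0_iff) (metis inner_gt_zero_iff not_less)
qed simp

lemma rank_projection_minimal:
  assumes "is_rank_projection r Y Z" "rank W \<le> r"
  shows "norm (Y - Z) \<le> norm (Y - W)"
  using assms by (force simp: is_rank_projection_def is_arg_min_def)

lemma rank_projection_rank_le:
  assumes "is_rank_projection r Y Z"
  shows "rank Z \<le> r"
  using assms by (simp add: is_rank_projection_def is_arg_min_def)

lemma rank_projection_transpose:
  assumes "is_rank_projection r Y Z"
  shows "is_rank_projection r (transpose Y) (transpose Z)"
  unfolding is_rank_projection_def is_arg_min_def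
proof safe
  show "rank (transpose Z) \<le> r"
    using assms by (simp add: rank_projection_rank_le rank_transpose)
next
  fix W :: "real^'a^'a"
  assume W: "rank W \<le> r" "norm (transpose Y - W) < norm (transpose Y - transpose Z)"
  have "norm (Y - Z) \<le> norm (Y - transpose W)"
    using assms W(1) by (intro rank_projection_minimal) (simp_all add: rank_transpose)
  then show False
    using W(2) norm_transpose_matrix [of "Y - Z"] norm_transpose_matrix [of "Y - transpose W"]
    by (simp add: transpose_diff)
qed

text \<open>Multiplying \<open>Z\<close> on the right never raises its rank, so all perturbations
  \<open>Z ** B\<close> are admissible. The choice of \<open>B\<close> as the product to be shown
  zero turns the first-order condition into \<open>inner ?A ?A = 0\<close>.\<close>

lemma rank_projection_residual_mult:
  fixes Y Z :: "real^'n^'n"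
  assumes "is_rank_projection r Y Z"
  shows "transpose Z ** (Y - Z) = 0"
proof -
  let ?A = "transpose Z ** (Y - Z)"
  have "inner (Y - Z) (Z ** ?A) = 0"
  proof (rule inner_zero_if_norm_minimal)
    fix t
    have "Z - t *\<^sub>R (Z ** ?A) = Z ** (mat 1 - t *\<^sub>R ?A)"
      by (simp add: matrix_mult_diff_distrib scaleR_matrix_mult)
    then have "rank (Z - t *\<^sub>R (Z ** ?A)) \<le> r"
      using rank_mul_le_left rank_projection_rank_le [OF assms] order_trans by metis
    from rank_projection_minimal [OF assms this]
    show "norm (Y - Z) \<le> norm (Y - Z + t *\<^sub>R (Z ** ?A))"
      by (simp add: algebra_simps)
  qed
  then have "inner ?A ?A = 0"
    by (metis inner_commute inner_matrix_mult_left)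
  then show ?thesis by simp
qed

text \<open>With rank to spare, every rank-one perturbation of \<open>Z\<close> is admissible, so
  the residual is orthogonal to all outer products.\<close>

lemma rank_projection_residual_zero:
  fixes Y Z :: "real^'n^'n"
  assumes "is_rank_projection r Y Z" "rank Z < r"
  shows "Y = Z"
proof -
  have "inner x ((Y - Z) *v y) = 0" for x y
  proof -
    have "inner (Y - Z) (outer_product x y) = 0"
    proof (rule inner_zero_if_norm_minimal)
      fix t
      have "rank (Z + (- t) *\<^sub>R outer_product x y) \<le> rank Z + 1"
        using rank_add_le [of Z "(- t) *\<^sub>R outer_product x y"]
          rank_scaleR_le [of "- t" "outer_product x y"] rank_outer_product_le [of x y] by linarith
      then have "rank (Z + (- t) *\<^sub>R outer_product x y) \<le> r" using assms(2) by linarith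
      from rank_projection_minimal [OF assms(1) this]
      show "norm (Y - Z) \<le> norm (Y - Z + t *\<^sub>R outer_product x y)"
        by (simp add: algebra_simps)
    qed
    then show ?thesis by (simp add: inner_outer_product)
  qed
  then have "(Y - Z) *v y = 0" for y by (metis inner_eq_zero_iff)
  then show ?thesis by (metis eq_iff_diff_eq_0 matrix_eq matrix_vector_mult_0)
qed

text \<open>
  The proof exchanges the component of \<open>Z\<close> along \<open>u\<close> for the rank-one piece of the residual
  along \<open>x\<close>, which must not bring \<open>Z\<close> closer to \<open>Y\<close>.
\<close>

lemma rank_projection_residual_le:
  fixes Y Z :: "real^'n^'n"
  assumes "is_rank_projection r Y Z" and u: "u \<in> range ((*v) Z)" "norm u = 1"
    and x: "norm x \<le> 1" "transpose Z *v x = 0"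
  shows "norm (transpose (Y - Z) *v x) \<le> norm (transpose Z *v u)"
proof -
  define R where "R = Y - Z"
  \<comment> \<open>The right partner of \<open>x\<close> in the residual, chosen so that
    \<open>c\<close> equals \<open>norm (transpose R *v x)\<close>. If that vector vanishes,
    division by zero gives \<open>y = 0\<close> and the equality survives, hence only
    \<open>norm y \<le> 1\<close> is claimed.\<close>
  define y where "y = (1 / norm (transpose R *v x)) *\<^sub>R (transpose R *v x)"
  define c where "c = inner x (R *v y)"
  define W where "W = (Z - outer_product u u ** Z) + c *\<^sub>R outer_product x y"
  have c: "c = norm (transpose R *v x)"
    by (simp add: c_def y_def transpose_matrix_vector dot_lmul_matrix [symmetric]
        power2_norm_eq_inner [symmetric] power2_eq_square)
  have y: "norm y \<le> 1" by (simp add: y_def)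
  have "rank W \<le> rank (Z - outer_product u u ** Z) + 1"
    unfolding W_def
    using rank_add_le [of "Z - outer_product u u ** Z" "c *\<^sub>R outer_product x y"]
      rank_scaleR_le [of c "outer_product x y"] rank_outer_product_le [of x y] by linarith
  also have "\<dots> \<le> r"
    using rank_deflation_less [OF u] rank_projection_rank_le [OF assms(1)] by linarith
  finally have "norm (Y - Z) \<le> norm (Y - W)"
    by (rule rank_projection_minimal [OF assms(1)])
  define a where "a = transpose Z *v u"
  have "Y - W = R + (outer_product u a - c *\<^sub>R outer_product x y)"
    by (simp add: W_def R_def a_def outer_product_matrix_mult)
  with \<open>norm (Y - Z) \<le> norm (Y - W)\<close>
  have "(norm R)\<^sup>2 \<le> (norm (R + (outer_product u a - c *\<^sub>R outer_product x y)))\<^sup>2"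
    by (simp add: R_def power_mono)
  \<comment> \<open>Both terms pairing \<open>outer_product u a\<close> with \<open>R\<close> and
    with \<open>outer_product x y\<close> will vanish, and
    \<open>inner R (outer_product x y) = c\<close>; what remains is
    \<open>c\<^sup>2 \<le> (norm a)\<^sup>2\<close>.\<close>
  then have *: "0 \<le> 2 * inner R (outer_product u a) - 2 * c * inner R (outer_product x y)
      + (norm (outer_product u a))\<^sup>2 + c * c * (norm (outer_product x y))\<^sup>2
      - 2 * c * inner (outer_product u a) (outer_product x y)"
    by (simp add: power2_norm_eq_inner inner_add_left inner_add_right inner_diff_left
        inner_diff_right inner_commute algebra_simps)
  have "R ** transpose Z = 0"
    using rank_projection_residual_mult [OF rank_projection_transpose [OF assms(1)]]
    unfolding R_def by (metis matrix_transpose_mul transpose_diff transpose_transpose transpose_zero)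
  then have 1: "inner R (outer_product u a) = 0"
    by (simp add: inner_outer_product a_def matrix_vector_mul_assoc)
  obtain v where v: "u = Z *v v" using u(1) by auto
  have "inner u x = 0"
    using x(2) by (simp add: v inner_commute transpose_matrix_vector dot_lmul_matrix [symmetric])
  then have 2: "inner (outer_product u a) (outer_product x y) = 0"
    by (simp add: inner_outer_product outer_product_mult_vec inner_commute)
  have "norm x * norm y \<le> 1" using x(1) y by (simp add: mult_le_one)
  then have "(norm (outer_product x y))\<^sup>2 \<le> 1"
    by (simp add: norm_outer_product power_le_one)
  then have "c * c * (norm (outer_product x y))\<^sup>2 \<le> c * c * 1"
    by (intro mult_left_mono) auto
  then have "c\<^sup>2 \<le> (norm a)\<^sup>2"
    using * 1 2 by (simp add: inner_outer_product norm_outer_product u(2) flip: c_def)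
      (simp add: power2_eq_square)
  then show ?thesis
    using c by (simp add: R_def a_def power2_le_iff_abs_le)
qed

text \<open>\<open>\<nu>\<close> is the spectral norm of the residual. It separates the spectra: the
  residual acts only on the complement of the range of \<open>Z\<close>, with singular values at
  most \<open>\<nu>\<close>, while the nonzero ones of \<open>Z\<close> are at least
  \<open>\<nu>\<close>.\<close>

lemma rank_projection_residual_spectrum:
  fixes Y Z :: "real^'n^'n"
  assumes "is_rank_projection r Y Z"
  obtains P \<nu> where "orthogonal_projector P" "range ((*v) P) = range ((*v) Z)"
    "(norm P)\<^sup>2 = real (rank Z)" "0 \<le> \<nu>"
    "\<And>w. norm (transpose (Y - Z) *v w) \<le> \<nu> * norm ((mat 1 - P) *v w)"
    "\<And>w. \<nu> * norm (P *v w) \<le> norm (transpose Z *v w)"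
proof -
  define R where "R = Y - Z"
  obtain P where P: "orthogonal_projector P" "range ((*v) P) = range ((*v) Z)"
    "P ** Z = Z" "(norm P)\<^sup>2 = real (rank Z)"
    using orthogonal_projector_onto_range [of Z] .
  have ZP: "transpose Z ** P = transpose Z"
    using P(1,3) by (metis matrix_transpose_mul orthogonal_projector_def)
  have "transpose R ** Z = 0"
    using rank_projection_residual_mult [OF assms]
    unfolding R_def by (metis matrix_transpose_mul transpose_transpose transpose_zero)
  then have RP: "transpose R *v (P *v w) = 0" for w
    using P(2) by (metis (no_types, lifting) imageE matrix_vector_mul_assoc matrix_vector_mult_0 rangeI)
  define \<nu> where "\<nu> = onorm ((*v) (transpose R))"
  have bl: "bounded_linear ((*v) (transpose R))" by simp
  have \<nu>0: "0 \<le> \<nu>" unfolding \<nu>_def by (rule onorm_pos_le [OF bl])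
  have split: "transpose R *v w = transpose R *v ((mat 1 - P) *v w)" for w
    by (simp add: matrix_vector_mult_diff_rdistrib matrix_vector_mult_diff_distrib RP)
  have upper: "norm (transpose R *v w) \<le> \<nu> * norm ((mat 1 - P) *v w)" for w
    by (subst split) (simp add: \<nu>_def onorm [OF bl])
  \<comment> \<open>\<open>transpose R\<close> sees only the component of \<open>w\<close>
    orthogonal to the range of \<open>Z\<close>; normalized, that component is an admissible
    \<open>x\<close> for the exchange argument.\<close>
  have unit: "\<nu> \<le> norm (transpose Z *v u)" if u: "u \<in> range ((*v) Z)" "norm u = 1" for u
    unfolding \<nu>_def
  proof (rule onorm_bound)
    fix w
    let ?q = "(mat 1 - P) *v w"
    have Zq: "transpose Z *v ?q = 0"
      by (simp add: matrix_vector_mul_assoc matrix_mult_diff_distrib ZP)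
    have "norm (transpose R *v ?q) \<le> norm (transpose Z *v u) * norm ?q"
    proof (cases "?q = 0")
      case False
      have "norm (transpose R *v ((1 / norm ?q) *\<^sub>R ?q)) \<le> norm (transpose Z *v u)"
        unfolding R_def using False
        by (intro rank_projection_residual_le [OF assms u]) (simp_all add: matrix_vector_mult_scaleR Zq)
      then show ?thesis
        using False by (simp add: matrix_vector_mult_scaleR field_simps)
    qed simp
    also have "\<dots> \<le> norm (transpose Z *v u) * norm w"
      by (intro mult_left_mono norm_orthogonal_projector_le P(1)) simp
    finally show "norm (transpose R *v w) \<le> norm (transpose Z *v u) * norm w"
      by (metis split)
  qed simp
  have lower: "\<nu> * norm (P *v w) \<le> norm (transpose Z *v w)" for w
  proof (cases "P *v w = 0")
    case False
    let ?u = "(1 / norm (P *v w)) *\<^sub>R (P *v w)"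
    have "?u \<in> range ((*v) Z)"
      using P(2) subspace_range_matrix [of Z] by (intro subspace_scale) auto
    then have "\<nu> \<le> norm (transpose Z *v ?u)" using False by (intro unit) simp_all
    then show ?thesis
      using False by (simp add: matrix_vector_mult_scaleR matrix_vector_mul_assoc ZP field_simps)
  qed simp
  show ?thesis
    using that [OF P(1,2,4) \<nu>0] upper lower unfolding R_def by blast
qed

text \<open>The residual would vanish on the range of \<open>P\<close> if that were the range of
  \<open>Z\<close>. The angle between the two ranges costs a factor \<open>\<nu>\<close>, which the
  singular values of \<open>Z\<close> pay back: the part of \<open>Z\<close> outside the range of
  \<open>P\<close> belongs to \<open>Z - X\<close>.\<close>

lemma rank_projection_residual_near:
  fixes X Y Z :: "real^'n^'n"
  assumes proj: "is_rank_projection r Y Z"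
    and P: "orthogonal_projector P" "P ** X = X" "(norm P)\<^sup>2 \<le> real r"
  shows "norm (P ** (Y - Z)) \<le> norm (Z - X)"
proof (cases "rank Z < r")
  case True
  then show ?thesis using rank_projection_residual_zero [OF proj] by simp
next
  case False
  obtain Q \<nu> where Q: "orthogonal_projector Q" "(norm Q)\<^sup>2 = real (rank Z)" "0 \<le> \<nu>"
    "\<And>w. norm (transpose (Y - Z) *v w) \<le> \<nu> * norm ((mat 1 - Q) *v w)"
    "\<And>w. \<nu> * norm (Q *v w) \<le> norm (transpose Z *v w)"
    using rank_projection_residual_spectrum [OF proj] by metis
  have tP: "transpose P = P" using P(1) by (simp add: orthogonal_projector_def)
  have "norm (P ** (Y - Z)) = norm (transpose (Y - Z) ** P)"
    using norm_transpose_matrix [of "P ** (Y - Z)"] by (simp add: matrix_transpose_mul tP)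
  also have "\<dots> \<le> norm ((\<nu> *\<^sub>R (mat 1 - Q)) ** P)"
    using Q(3,4) by (intro norm_matrix_mult_mono) (simp flip: scaleR_matrix_vector_assoc)
  also have "\<dots> = \<nu> * norm ((mat 1 - Q) ** P)"
    using Q(3) by (simp add: scaleR_matrix_mult)
  \<comment> \<open>Dimension count: here \<open>rank Z = r\<close>, so the squared norm of
    \<open>P\<close> does not exceed that of \<open>Q\<close>, and subtracting the common
    \<open>norm (Q ** P)\<close> preserves this.\<close>
  also have "\<dots> \<le> \<nu> * norm (Q ** (mat 1 - P))"
  proof (intro mult_left_mono Q(3))
    have "(norm ((mat 1 - Q) ** P))\<^sup>2 = (norm P)\<^sup>2 - (norm (Q ** P))\<^sup>2"
      using orthogonal_projector_pythagoras [OF Q(1), of P] by simp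
    also have "\<dots> \<le> (norm Q)\<^sup>2 - (norm (P ** Q))\<^sup>2"
      using P(3) Q(2) False norm_mult_orthogonal_projectors_commute [OF P(1) Q(1)] by simp
    also have "\<dots> = (norm ((mat 1 - P) ** Q))\<^sup>2"
      using orthogonal_projector_pythagoras [OF P(1), of Q] by simp
    also have "\<dots> = (norm (Q ** (mat 1 - P)))\<^sup>2"
      using norm_mult_orthogonal_projectors_commute [OF Q(1) orthogonal_projector_complement [OF P(1)]]
      by simp
    finally show "norm ((mat 1 - Q) ** P) \<le> norm (Q ** (mat 1 - P))"
      by (rule power2_le_imp_le) simp
  qed
  also have "\<dots> = norm ((\<nu> *\<^sub>R Q) ** (mat 1 - P))"
    using Q(3) by (simp add: scaleR_matrix_mult)
  also have "\<dots> \<le> norm (transpose Z ** (mat 1 - P))"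
    using Q(3,5) by (intro norm_matrix_mult_mono) (simp flip: scaleR_matrix_vector_assoc)
  also have "transpose Z ** (mat 1 - P) = transpose (Z - X) ** (mat 1 - P)"
    using P(2) tP matrix_transpose_mul [of P X]
    by (simp add: transpose_diff matrix_mult_diff_distrib)
  also have "norm \<dots> \<le> norm (Z - X)"
    using norm_orthogonal_projector_le_right(2) [OF P(1)] by (metis norm_transpose_matrix)
  finally show ?thesis .
qed

subsection \<open>Lower bound for the step length\<close>

text \<open>
  An Eckart-Young type bound for \<open>X - M\<close>, whose summands have orthogonal row and column spaces:
  replacing singular values of \<open>X\<close>, all at least \<open>\<sigma>\<close>, by singular values of \<open>M\<close> in a best
  approximation gains at most the factor \<open>\<kappa>\<close>.
\<close>

lemma rank_approximation_error_ge:
  fixes X M W P :: "real^'n^'n"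
  assumes P: "orthogonal_projector P" "real r \<le> (norm P)\<^sup>2"
    and k: "0 \<le> \<kappa>" "\<kappa> \<le> 1" and s: "0 \<le> \<sigma>"
    and X: "\<And>u. \<sigma> * norm (P *v u) \<le> norm (transpose X *v u)"
    and M: "\<And>u. \<kappa> * norm (transpose M *v u) \<le> \<sigma> * norm ((mat 1 - P) *v u)"
    and XM: "X ** transpose M = 0"
    and W: "rank W \<le> r"
  shows "\<kappa> * norm M \<le> norm (X - M - W)"
proof -
  obtain Q where Q: "orthogonal_projector Q" "Q ** W = W" "(norm Q)\<^sup>2 = real (rank W)"
    using orthogonal_projector_onto_range [of W] by metis
  define C where "C = mat 1 - Q"
  have C: "orthogonal_projector C"
    unfolding C_def by (rule orthogonal_projector_complement [OF Q(1)])
  have comm: "norm (A ** B) = norm (transpose B ** A)" if "orthogonal_projector A"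
    for A B :: "real^'n^'n"
    using that norm_transpose_matrix [of "A ** B"]
    by (simp add: matrix_transpose_mul orthogonal_projector_def)
  have "norm ((\<sigma> *\<^sub>R P) ** C) \<le> norm (transpose X ** C)"
    using X s by (intro norm_matrix_mult_mono) (simp flip: scaleR_matrix_vector_assoc)
  then have a: "\<sigma> * norm (C ** P) \<le> norm (C ** X)"
    using s comm [OF C, of X] norm_mult_orthogonal_projectors_commute [OF C P(1)]
    by (simp add: scaleR_matrix_mult)
  have "norm ((\<kappa> *\<^sub>R transpose M) ** Q) \<le> norm ((\<sigma> *\<^sub>R (mat 1 - P)) ** Q)"
    using M s k(1) by (intro norm_matrix_mult_mono) (simp flip: scaleR_matrix_vector_assoc)
  then have b: "\<kappa> * norm (Q ** M) \<le> \<sigma> * norm ((mat 1 - P) ** Q)"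
    using s k(1) comm [OF Q(1), of M] by (simp add: scaleR_matrix_mult)
  \<comment> \<open>The part of \<open>M\<close> outside the column space of \<open>W\<close> is
    kept in full. The part inside is traded, by counting dimensions, against what \<open>W\<close>
    must then miss of \<open>X\<close>.\<close>
  have "(\<kappa> * norm M)\<^sup>2 = \<kappa>\<^sup>2 * (norm (C ** M))\<^sup>2 + (\<kappa> * norm (Q ** M))\<^sup>2"
    using orthogonal_projector_pythagoras [OF Q(1), of M]
    by (simp add: C_def power_mult_distrib flip: distrib_left)
  also have "\<dots> \<le> (norm (C ** M))\<^sup>2 + (\<sigma> * norm ((mat 1 - P) ** Q))\<^sup>2"
    using b k by (intro add_mono power_mono mult_left_le_one_le power_le_one) auto
  also have "(\<sigma> * norm ((mat 1 - P) ** Q))\<^sup>2 = \<sigma>\<^sup>2 * ((norm Q)\<^sup>2 - (norm (P ** Q))\<^sup>2)"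
    using orthogonal_projector_pythagoras [OF P(1), of Q] by (simp add: power_mult_distrib)
  also have "\<dots> \<le> \<sigma>\<^sup>2 * ((norm P)\<^sup>2 - (norm (Q ** P))\<^sup>2)"
    using P(2) Q(3) W norm_mult_orthogonal_projectors_commute [OF P(1) Q(1)]
    by (intro mult_left_mono) auto
  also have "\<dots> = (\<sigma> * norm (C ** P))\<^sup>2"
    using orthogonal_projector_pythagoras [OF Q(1), of P]
    by (simp add: C_def power_mult_distrib flip: diff_eq_eq)
  also have "\<dots> \<le> (norm (C ** X))\<^sup>2"
    using a s by (intro power_mono) auto
  \<comment> \<open>\<open>X ** transpose M = 0\<close> makes \<open>C ** X\<close> and
    \<open>C ** M\<close> orthogonal.\<close>
  also have "(norm (C ** M))\<^sup>2 + (norm (C ** X))\<^sup>2 = (norm (C ** X - C ** M))\<^sup>2"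
  proof -
    have "inner (C ** X) (C ** M) = inner C (C ** (M ** transpose X))"
      by (simp add: inner_matrix_mult_right [of C X] matrix_mul_assoc)
    also have "M ** transpose X = 0"
      using XM by (metis matrix_transpose_mul transpose_transpose transpose_zero)
    finally show ?thesis
      by (simp add: power2_norm_eq_inner inner_diff_left inner_diff_right inner_commute)
  qed
  also have "C ** X - C ** M = C ** (X - M - W)"
    using Q(2) by (simp add: C_def matrix_mult_diff_distrib)
  also have "(norm (C ** (X - M - W)))\<^sup>2 \<le> (norm (X - M - W))\<^sup>2"
    by (intro power_mono norm_orthogonal_projector_le C) simp
  finally show ?thesis by (rule power2_le_imp_le) simp_all
qed

text \<open>A vector of \<open>S\<close> killed by \<open>P\<close> is killed by
  \<open>transpose X\<close>, hence zero; so \<open>P\<close> maps \<open>S\<close> onto the range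
  of \<open>X\<close>. Each \<open>P *v w\<close> then comes from some \<open>u\<close> in
  \<open>S\<close> that is at least as long. The lemma is applied with the range of \<open>Z\<close>
  as \<open>S\<close>.\<close>

lemma smallest_singular_value_transfer:
  fixes X P :: "real^'n^'n"
  assumes S: "subspace S" "rank X \<le> dim S"
    and P: "orthogonal_projector P" "range ((*v) P) = range ((*v) X)"
    and s: "0 < \<sigma>" "\<And>u. u \<in> S \<Longrightarrow> \<sigma> * norm u \<le> norm (transpose X *v u)"
  shows "rank X = dim S" "\<sigma> * norm (P *v w) \<le> norm (transpose X *v w)"
proof -
  have "P ** X = X" using P by (simp add: orthogonal_projector_mult_id)
  then have "transpose X ** P = transpose X"
    using P(1) by (metis matrix_transpose_mul orthogonal_projector_def)
  then have XP: "transpose X *v (P *v u) = transpose X *v u" for u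
    by (simp add: matrix_vector_mul_assoc)
  have inj: "u = 0" if "u \<in> S" "P *v u = 0" for u
    using s(2) [OF that(1)] XP [of u] that(2) s(1) by (simp add: mult_le_0_iff)
  have "inj_on ((*v) P) S"
    using linear_inj_on_iff_eq_0 [OF matrix_vector_mul_linear [of P] S(1)] inj by blast
  then have dim: "dim ((*v) P ` S) = dim S"
    using S(1) by (intro dim_image_eq) (auto simp: span_eq_iff [THEN iffD2])
  have sub: "(*v) P ` S \<subseteq> range ((*v) X)" using P(2) by auto
  then show rank: "rank X = dim S"
    using S(2) dim dim_subset [OF sub] by (simp add: rank_dim_range)
  have "(*v) P ` S = range ((*v) X)"
    using sub dim rank S(1)
    by (intro subspace_dim_equal linear_subspace_image subspace_range_matrix)
      (simp_all add: rank_dim_range)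
  then obtain u where u: "u \<in> S" "P *v w = P *v u"
    using P(2) by (metis imageE rangeI)
  have "\<sigma> * norm (P *v w) \<le> \<sigma> * norm u"
    unfolding u(2) using s(1) by (intro mult_left_mono norm_orthogonal_projector_le P(1)) simp
  also have "\<dots> \<le> norm (transpose X *v w)"
    using s(2) [OF u(1)] XP [of u] XP [of w] u(2) by simp
  finally show "\<sigma> * norm (P *v w) \<le> norm (transpose X *v w)" .
qed

text \<open>Completing the square: the points \<open>a\<close> with
  \<open>norm (a - b) \<le> k * norm a\<close> form the Apollonius ball with centre
  \<open>b / (1 - k\<^sup>2)\<close> and radius \<open>k\<close> times the norm of that
  centre.\<close>

lemma relative_distance_swap:
  fixes a b :: "'a::real_inner"
  assumes "norm (a - b) \<le> k * norm a" "0 \<le> k" "k < 1"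
  shows "norm (a - (1 / (1 - k\<^sup>2)) *\<^sub>R b) \<le> k * norm ((1 / (1 - k\<^sup>2)) *\<^sub>R b)"
proof -
  have k1: "0 < 1 - k\<^sup>2" using assms(2,3) by (simp add: abs_square_less_1)
  define c where "c = (1 / (1 - k\<^sup>2)) *\<^sub>R b"
  have b: "b = (1 - k\<^sup>2) *\<^sub>R c" using k1 by (simp add: c_def)
  have "(norm (a - b))\<^sup>2 \<le> (k * norm a)\<^sup>2" by (intro power_mono assms) simp
  then have "inner a a - 2 * inner a b + inner b b \<le> k\<^sup>2 * inner a a"
    by (simp add: power_mult_distrib power2_norm_eq_inner inner_diff_left inner_diff_right inner_commute)
  then have "(1 - k\<^sup>2) * (inner a a - 2 * inner a c + (1 - k\<^sup>2) * inner c c) \<le> 0"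
    by (simp add: b algebra_simps)
  then have "inner a a - 2 * inner a c + (1 - k\<^sup>2) * inner c c \<le> 0"
    using k1 by (simp add: mult_le_0_iff)
  then have "(norm (a - c))\<^sup>2 \<le> (k * norm c)\<^sup>2"
    by (simp add: power_mult_distrib power2_norm_eq_inner inner_diff_left inner_diff_right
        inner_commute algebra_simps)
  then show ?thesis unfolding c_def [symmetric]
    by (rule power2_le_imp_le) (simp add: assms)
qed

text \<open>\<open>h\<close> and \<open>V\<close> are step size and gradient rescaled by
  \<open>(L + \<mu>) / 2\<close> and its inverse. \<open>m1\<close> pays for displacement and
  tangential residual, of sizes \<open>d\<close> and \<open>sqrt 2 * d\<close> before division by
  \<open>h\<close>. \<open>m2\<close> keeps the singular values of \<open>X\<close> above \<kappa>
  times the bound on the spectral norm of \<open>M\<close>.\<close>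

lemma rank_projection_step_ge:
  fixes X Xs V Z :: "real^'n^'n"
  assumes rX: "rank X \<le> r" and rXs: "rank Xs \<le> r"
    and proj: "is_rank_projection r (X - h *\<^sub>R V) Z" and h: "0 < h"
    and V: "\<And>P. orthogonal_projector P \<Longrightarrow> P ** X = X \<Longrightarrow> P ** Xs = Xs \<Longrightarrow> rank P \<le> 2 * r \<Longrightarrow>
      norm (P ** V - (X - Xs)) \<le> \<kappa>\<^sub>0 * norm (X - Xs)"
    and k: "0 < \<kappa>" "\<kappa> < 1 / 2"
    and m1: "\<kappa>\<^sub>0 + (1 + sqrt 2) * m / h \<le> \<kappa>"
    and m2: "\<kappa> / (1 - \<kappa>\<^sup>2) + 2 * sqrt (real r) * m \<le> h"
  shows "m * norm (X - Xs) \<le> norm (Z - X)"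
proof (rule ccontr)
  define Y where "Y = X - h *\<^sub>R V"
  define R where "R = Y - Z"
  define d where "d = norm (Z - X)"
  define \<Delta> where "\<Delta> = X - Xs"
  assume "\<not> ?thesis"
  then have dm: "d < m * norm \<Delta>" by (simp add: d_def \<Delta>_def)
  moreover have d0: "0 \<le> d" by (simp add: d_def)
  ultimately have "0 < m * norm \<Delta>" by linarith
  then have m: "0 < m" and \<Delta>: "0 < norm \<Delta>"
    by (simp_all add: zero_less_mult_iff)
  have proj: "is_rank_projection r Y Z" using proj by (simp add: Y_def)
  have k1: "0 < 1 - \<kappa>\<^sup>2" using k by (simp add: abs_square_less_1)

  obtain PX where PX: "orthogonal_projector PX" "range ((*v) PX) = range ((*v) X)" "PX ** X = X"
    "(norm PX)\<^sup>2 = real (rank X)"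
    using orthogonal_projector_onto_range [of X] .
  obtain QX where QX: "orthogonal_projector QX" "QX ** transpose X = transpose X"
    "(norm QX)\<^sup>2 = real (rank X)"
    using orthogonal_projector_onto_range [of "transpose X"] rank_transpose by metis
  obtain P where P: "orthogonal_projector P" "P ** X = X" "P ** Xs = Xs"
    "rank P \<le> rank X + rank Xs" "(norm P)\<^sup>2 \<le> real (rank X + rank Xs)"
    "range ((*v) X) \<subseteq> range ((*v) P)"
    using orthogonal_projector_onto_sum [of X Xs] by metis
  have XQ: "X ** QX = X"
    using QX(1,2) by (metis matrix_transpose_mul orthogonal_projector_def transpose_transpose)
  have PPX: "P ** PX = PX"
    using P(1,6) PX(2) by (intro orthogonal_projector_mult_id) auto
  then have PXP: "PX ** P = PX"
    using P(1) PX(1) by (metis matrix_transpose_mul orthogonal_projector_def)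
  \<comment> \<open>Projector onto the directions that \<open>Xs\<close> adds to the column space of
    \<open>X\<close>; there are at most \<open>r\<close> of them.\<close>
  define E where "E = P - PX"
  have E: "E = (mat 1 - PX) ** P" "E = P ** (mat 1 - PX)" "transpose E = E" "PX ** E = 0"
    using P(1) PX(1)
    by (simp_all add: E_def PPX PXP matrix_mult_diff_distrib transpose_diff orthogonal_projector_def)
  have "(norm E)\<^sup>2 \<le> real r"
    using orthogonal_projector_pythagoras [OF PX(1), of P] P(5) PX(4) rXs by (simp add: E(1) PXP)
  then have normE: "norm E \<le> sqrt (real r)" by (simp add: real_le_rsqrt)

  \<comment> \<open>The tangential part of the projected residual at \<open>X\<close>, with
    \<open>RN\<close> below as the normal part: \<open>RN\<close> is orthogonal to both the column
    and the row space of \<open>X\<close>.\<close>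
  define RT where "RT = PX ** R + E ** (R ** QX)"
  define RN where "RN = E ** (R ** (mat 1 - QX))"
  have PR: "P ** R = RT + RN"
    by (simp add: RT_def RN_def E_def matrix_mult_diff_distrib)
  have "norm (PX ** R) \<le> d"
    unfolding R_def d_def using PX rX by (intro rank_projection_residual_near [OF proj]) auto
  moreover have "norm (E ** (R ** QX)) \<le> d"
  proof -
    have "norm (E ** (R ** QX)) \<le> norm (R ** QX)"
      unfolding E(1) matrix_mul_assoc [symmetric]
      by (intro order_trans [OF norm_orthogonal_projector_le(2) [OF PX(1)]]
          norm_orthogonal_projector_le(1) P(1))
    also have "\<dots> = norm (QX ** (transpose Y - transpose Z))"
      using norm_transpose_matrix [of "R ** QX"] QX(1)
      by (simp add: matrix_transpose_mul R_def transpose_diff orthogonal_projector_def)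
    also have "\<dots> \<le> norm (transpose Z - transpose X)"
      using QX rX by (intro rank_projection_residual_near [OF rank_projection_transpose [OF proj]]) auto
    also have "\<dots> = d"
      using norm_transpose_matrix [of "Z - X"] by (simp add: d_def transpose_diff)
    finally show ?thesis .
  qed
  \<comment> \<open>The two blocks, each of norm at most \<open>d\<close>, have orthogonal column
    spaces; this gives \<open>sqrt 2 * d\<close> instead of \<open>2 * d\<close>.\<close>
  moreover have "(norm RT)\<^sup>2 = (norm (PX ** R))\<^sup>2 + (norm (E ** (R ** QX)))\<^sup>2"
  proof -
    have "PX ** RT = PX ** R"
      using PX(1)
      by (simp add: RT_def matrix_mult_add_distrib matrix_mul_assoc E(4) orthogonal_projector_def)
    moreover from this have "(mat 1 - PX) ** RT = E ** (R ** QX)"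
      by (simp add: matrix_mult_diff_distrib) (simp add: RT_def)
    ultimately show ?thesis
      using orthogonal_projector_pythagoras [OF PX(1), of RT] by simp
  qed
  ultimately have "(norm RT)\<^sup>2 \<le> d\<^sup>2 + d\<^sup>2"
    using add_mono power_mono norm_ge_zero by metis
  then have "(norm RT)\<^sup>2 \<le> (sqrt 2 * d)\<^sup>2" by (simp add: power_mult_distrib)
  then have RT: "norm RT \<le> sqrt 2 * d" by (rule power2_le_imp_le) (simp add: d0)

  \<comment> \<open>What remains of \<open>P ** V\<close> when the terms of order \<open>d\<close>
    are dropped.\<close>
  define N where "N = - (1 / h) *\<^sub>R RN"
  have "\<Delta> - N = - (P ** V - \<Delta>) - (1 / h) *\<^sub>R (P ** (Z - X) + RT)"
  proof -
    have "h *\<^sub>R (P ** V) = - (P ** (Z - X)) - RT - RN"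
    proof -
      have "h *\<^sub>R V = - (Z - X) - R" by (simp add: R_def Y_def)
      then have "P ** (h *\<^sub>R V) = P ** (- (Z - X) - R)" by simp
      also have "\<dots> = - (P ** (Z - X)) - P ** R"
        by (simp only: matrix_mult_diff_distrib minus_diff_eq)
      finally show ?thesis by (simp add: scaleR_matrix_mult PR)
    qed
    then have eq: "P ** V = (1 / h) *\<^sub>R (- (P ** (Z - X)) - RT - RN)"
      using h by (metis divideR_right inverse_eq_divide less_irrefl)
    show ?thesis unfolding eq N_def by (simp add: algebra_simps)
  qed
  then have "norm (\<Delta> - N) \<le> norm (P ** V - \<Delta>) + norm ((1 / h) *\<^sub>R (P ** (Z - X) + RT))"
    using norm_triangle_ineq4 [of "- (P ** V - \<Delta>)"] by (simp only: norm_minus_cancel)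
  also have "\<dots> \<le> \<kappa>\<^sub>0 * norm \<Delta> + (1 / h) * (d + sqrt 2 * d)"
  proof (intro add_mono)
    show "norm (P ** V - \<Delta>) \<le> \<kappa>\<^sub>0 * norm \<Delta>"
      unfolding \<Delta>_def using P rX rXs by (intro V) auto
    have "norm (P ** (Z - X) + RT) \<le> d + sqrt 2 * d"
      using norm_triangle_ineq norm_orthogonal_projector_le(1) [OF P(1), of "Z - X"] RT
      unfolding d_def by (smt (verit))
    then show "norm ((1 / h) *\<^sub>R (P ** (Z - X) + RT)) \<le> (1 / h) * (d + sqrt 2 * d)"
      using h by (simp add: divide_right_mono)
  qed
  also have "(1 / h) * (d + sqrt 2 * d) \<le> (1 / h) * ((1 + sqrt 2) * (m * norm \<Delta>))"
  proof (rule mult_left_mono)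
    have "(1 + sqrt 2) * d \<le> (1 + sqrt 2) * (m * norm \<Delta>)"
      using dm by (intro mult_left_mono) auto
    then show "d + sqrt 2 * d \<le> (1 + sqrt 2) * (m * norm \<Delta>)"
      by (simp add: distrib_right)
  qed (use h in simp)
  also have "\<kappa>\<^sub>0 * norm \<Delta> + (1 / h) * ((1 + sqrt 2) * (m * norm \<Delta>))
      = (\<kappa>\<^sub>0 + (1 + sqrt 2) * m / h) * norm \<Delta>"
    by (simp add: algebra_simps add_divide_distrib)
  also have "\<dots> \<le> \<kappa> * norm \<Delta>"
    using m1 by (intro mult_right_mono) auto
  finally have \<Delta>N: "norm (\<Delta> - N) \<le> \<kappa> * norm \<Delta>" by simp

  obtain Q \<nu> where Q: "orthogonal_projector Q" "range ((*v) Q) = range ((*v) Z)" "0 \<le> \<nu>"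
    and R\<nu>: "\<And>w. norm (transpose R *v w) \<le> \<nu> * norm ((mat 1 - Q) *v w)"
    and Z\<nu>: "\<And>w. \<nu> * norm (Q *v w) \<le> norm (transpose Z *v w)"
    using rank_projection_residual_spectrum [OF proj] unfolding R_def by metis
  have R\<nu>1: "norm (transpose R *v w) \<le> \<nu> * norm w" for w
    using R\<nu> [of w] mult_left_mono [OF norm_orthogonal_projector_le(4) [OF Q(1), of w] Q(3)]
    by linarith
  have "norm RN \<le> norm (E ** R)"
    unfolding RN_def matrix_mul_assoc by (rule norm_orthogonal_projector_le_right(2) [OF QX(1)])
  also have "\<dots> = norm (transpose R ** E)"
    using norm_transpose_matrix [of "E ** R"] by (simp add: matrix_transpose_mul E(3))
  also have "\<dots> \<le> norm ((\<nu> *\<^sub>R mat 1) ** E)"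
    using R\<nu>1 Q(3) by (intro norm_matrix_mult_mono) (simp flip: scaleR_matrix_vector_assoc)
  also have "\<dots> \<le> \<nu> * sqrt (real r)"
    using Q(3) normE by (simp add: scaleR_matrix_mult mult_left_mono)
  finally have RN: "norm RN \<le> \<nu> * sqrt (real r)" .
  \<comment> \<open>As \<kappa> is below 1/2, \<open>N\<close> carries more than half of \<Delta>.
    Since \<open>RN\<close> has norm at most \<open>\<nu> * sqrt r\<close>, this bounds \<Delta> by
    \<nu> and produces the \<open>2 * sqrt r\<close> in \<open>m2\<close>.\<close>
  have "(1 - \<kappa>) * norm \<Delta> \<le> norm N"
    using norm_triangle_ineq2 [of \<Delta> N] \<Delta>N by (simp add: algebra_simps)
  moreover have "(1 / 2) * norm \<Delta> < (1 - \<kappa>) * norm \<Delta>"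
    using k \<Delta> by (intro mult_strict_right_mono) auto
  ultimately have "norm \<Delta> < 2 * norm N" by simp
  also have "2 * norm N \<le> 2 * (\<nu> * sqrt (real r)) / h"
    using RN h by (simp add: N_def divide_right_mono)
  finally have \<Delta>\<nu>: "norm \<Delta> < 2 * (\<nu> * sqrt (real r)) / h" .
  have N0: "N \<noteq> 0"
    using \<open>norm \<Delta> < 2 * norm N\<close> \<Delta> by auto
  have \<nu>: "0 < \<nu>"
    using \<Delta>\<nu> \<Delta> Q(3) by (cases "\<nu> = 0") auto

  \<comment> \<open>Weyl's perturbation bound: \<nu> bounds the singular values on the range of
    \<open>Z\<close>, and passing to \<open>X\<close> costs at most \<open>d\<close>. By
    \<open>m2\<close>, \<sigma> exceeds \<open>\<theta> * \<nu> / h\<close>.\<close>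
  define \<sigma> where "\<sigma> = \<nu> - d"
  define \<theta> where "\<theta> = \<kappa> / (1 - \<kappa>\<^sup>2)"
  have \<theta>: "0 < \<theta>" using k k1 by (simp add: \<theta>_def)
  have "d < m * (2 * (\<nu> * sqrt (real r)) / h)"
    using dm mult_strict_left_mono [OF \<Delta>\<nu> m] by linarith
  also have "\<dots> = (2 * sqrt (real r) * m) * \<nu> / h" by simp
  also have "\<dots> \<le> (h - \<theta>) * \<nu> / h"
    using m2 \<nu> h unfolding \<theta>_def [symmetric] by (intro divide_right_mono mult_right_mono) auto
  also have "\<dots> = \<nu> - \<theta> * \<nu> / h" using h by (simp add: field_simps)
  finally have \<sigma>: "\<theta> * \<nu> / h < \<sigma>" by (simp add: \<sigma>_def)
  moreover have "0 < \<theta> * \<nu> / h" using \<theta> \<nu> h by simp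
  ultimately have \<sigma>0: "0 < \<sigma>" by linarith

  \<comment> \<open>A nonzero residual forces \<open>rank Z = r\<close>, so the range of
    \<open>Z\<close> is large enough for the transfer to \<open>X\<close>.\<close>
  have "Y \<noteq> Z"
  proof
    assume "Y = Z"
    then have "N = 0" by (simp add: N_def RN_def R_def)
    with N0 show False by simp
  qed
  then have rZ: "rank Z = r"
    using rank_projection_residual_zero [OF proj] rank_projection_rank_le [OF proj] by linarith
  have "\<sigma> * norm u \<le> norm (transpose X *v u)" if "u \<in> range ((*v) Z)" for u
  proof -
    have "\<nu> * norm u \<le> norm (transpose Z *v u)"
      using Z\<nu> [of u] orthogonal_projector_fixes_range [OF Q(1), of u] that Q(2) by simp
    also have "transpose Z *v u = transpose X *v u + transpose (Z - X) *v u"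
      by (simp add: transpose_diff matrix_vector_mult_diff_rdistrib)
    also have "norm \<dots> \<le> norm (transpose X *v u) + norm (transpose (Z - X) *v u)"
      by (rule norm_triangle_ineq)
    also have "norm (transpose (Z - X) *v u) \<le> d * norm u"
      using norm_matrix_vector_mult_le [of "transpose (Z - X)" u]
      by (simp add: d_def norm_transpose_matrix)
    finally show ?thesis by (simp add: \<sigma>_def algebra_simps)
  qed
  note sv = smallest_singular_value_transfer
    [OF subspace_range_matrix [of Z] _ PX(1,2) \<sigma>0 this, unfolded rank_dim_range [symmetric] rZ, OF rX]

  \<comment> \<open>Centre of the ball to which \<open>relative_distance_swap\<close> confines
    \<Delta>. Below, \<tau> bounds its spectral norm, and
    \<open>\<kappa> * \<tau> = \<theta> * \<nu> / h\<close> is less than \<sigma>.\<close>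
  define M where "M = (1 / (1 - \<kappa>\<^sup>2)) *\<^sub>R N"
  define \<tau> where "\<tau> = \<nu> / (h * (1 - \<kappa>\<^sup>2))"
  have \<tau>: "0 < \<tau>" using \<nu> h k1 by (simp add: \<tau>_def)
  have "\<kappa> * \<tau> = \<theta> * \<nu> / h" by (simp add: \<tau>_def \<theta>_def)
  then have "\<kappa> < \<sigma> / \<tau>" using \<sigma> \<tau> by (simp add: pos_less_divide_eq)
  \<comment> \<open>A factor strictly above \<kappa> that still satisfies the Eckart-Young type
    bound, which needs \<open>k' \<le> 1\<close> and \<open>k' * \<tau> \<le> \<sigma>\<close>. The
    two bounds on \<open>norm (\<Delta> - M)\<close> then force \<open>M = 0\<close>.\<close>
  define k' where "k' = min 1 (\<sigma> / \<tau>)"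
  have k': "\<kappa> < k'" "0 \<le> k'" "k' \<le> 1" "k' * \<tau> \<le> \<sigma>"
    using \<open>\<kappa> < \<sigma> / \<tau>\<close> k \<tau> \<sigma>0 by (auto simp: k'_def min_def field_simps)
  have tM: "transpose M = - (1 / (h * (1 - \<kappa>\<^sup>2))) *\<^sub>R ((mat 1 - QX) ** (transpose R ** E))"
  proof -
    have "transpose RN = (mat 1 - QX) ** (transpose R ** E)"
      using orthogonal_projector_complement [OF QX(1)]
      by (simp add: RN_def matrix_transpose_mul E(3) orthogonal_projector_def matrix_mul_assoc)
    then show ?thesis by (simp add: M_def N_def transpose_uminus transpose_scalar mult.commute)
  qed
  have "k' * norm M \<le> norm (X - M - Xs)"
  proof (rule rank_approximation_error_ge [where P = PX and r = r and \<sigma> = \<sigma>])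
    show "real r \<le> (norm PX)\<^sup>2" using PX(4) sv(1) by simp
    show "X ** transpose M = 0"
      unfolding tM scaleR_matrix_mult matrix_mul_assoc
      by (simp add: matrix_mult_diff_distrib XQ)
    fix u
    have "norm (transpose M *v u) = (1 / (h * (1 - \<kappa>\<^sup>2))) * norm ((mat 1 - QX) *v (transpose R *v (E *v u)))"
    proof -
      have "transpose M *v u
          = - (1 / (h * (1 - \<kappa>\<^sup>2))) *\<^sub>R ((mat 1 - QX) *v (transpose R *v (E *v u)))"
        unfolding tM scaleR_matrix_vector_assoc [symmetric]
        by (simp only: matrix_vector_mul_assoc matrix_mul_assoc)
      then show ?thesis using h k1 by simp
    qed
    also have "\<dots> \<le> (1 / (h * (1 - \<kappa>\<^sup>2))) * (\<nu> * norm ((mat 1 - PX) *v u))"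
    proof (intro mult_left_mono)
      have "norm ((mat 1 - QX) *v (transpose R *v (E *v u))) \<le> norm (transpose R *v (E *v u))"
        by (rule norm_orthogonal_projector_le(4) [OF QX(1)])
      also have "\<dots> \<le> \<nu> * norm (E *v u)" by (rule R\<nu>1)
      also have "norm (E *v u) \<le> norm ((mat 1 - PX) *v u)"
        unfolding E(2) matrix_vector_mul_assoc [symmetric]
        by (rule norm_orthogonal_projector_le(3) [OF P(1)])
      finally show "norm ((mat 1 - QX) *v (transpose R *v (E *v u))) \<le> \<nu> * norm ((mat 1 - PX) *v u)"
        using Q(3) by (simp add: mult_left_mono)
    qed (use h k1 in simp)
    also have "\<dots> = \<tau> * norm ((mat 1 - PX) *v u)" by (simp add: \<tau>_def)
    finally have "k' * norm (transpose M *v u) \<le> k' * (\<tau> * norm ((mat 1 - PX) *v u))"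
      using k'(2) by (rule mult_left_mono)
    also have "\<dots> \<le> \<sigma> * norm ((mat 1 - PX) *v u)"
      using k'(4) by (simp add: mult.assoc [symmetric] mult_right_mono)
    finally show "k' * norm (transpose M *v u) \<le> \<sigma> * norm ((mat 1 - PX) *v u)" .
  qed (use PX sv k' \<sigma>0 rXs in auto)
  also have "X - M - Xs = \<Delta> - M" by (simp add: \<Delta>_def)
  also have "norm (\<Delta> - M) \<le> \<kappa> * norm M"
    unfolding M_def using k \<Delta>N by (intro relative_distance_swap) auto
  finally have "(k' - \<kappa>) * norm M \<le> 0" by (simp add: algebra_simps)
  then have "M = 0" using k'(1) by (simp add: mult_le_0_iff)
  then show False using N0 k1 by (simp add: M_def)
qed

subsection \<open>Restricted smoothness and contraction\<close>

lemma quadratic_upper_bound_unit_interval: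
  fixes q q' :: "real \<Rightarrow> real"
  assumes deriv: "\<And>t. (q has_real_derivative q' t) (at t)"
    and bound: "\<And>t. 0 \<le> t \<Longrightarrow> t \<le> 1 \<Longrightarrow> q' t \<le> q' 0 + c * t"
  shows "q 1 \<le> q 0 + q' 0 + c / 2"
proof -
  let ?F = "\<lambda>t. q t - q' 0 * t - c / 2 * t\<^sup>2"
  have "?F 1 \<le> ?F 0"
  proof (rule DERIV_nonpos_imp_nonincreasing [of 0 1 ?F])
    fix t :: real assume t: "0 \<le> t" "t \<le> 1"
    have "((\<lambda>t. q t - q' 0 * t - c / 2 * t\<^sup>2) has_real_derivative q' t - q' 0 - c * t) (at t)"
      by (auto intro!: derivative_eq_intros deriv)
    then show "\<exists>y. ((\<lambda>t. q t - q' 0 * t - c / 2 * t\<^sup>2) has_real_derivative y) (at t) \<and> y \<le> 0"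
      using bound [OF t] by (intro exI conjI) auto
  qed simp
  then show ?thesis by simp
qed

lemma differentiable_along_line:
  fixes f :: "'a::euclidean_space \<Rightarrow> real"
  assumes "\<And>x. f differentiable (at x)"
  shows "((\<lambda>t. f (x + t *\<^sub>R e)) has_real_derivative inner (gradient f (x + t *\<^sub>R e)) e) (at t)"
proof -
  have "(f has_derivative (\<lambda>h. inner h (gradient f (x + t *\<^sub>R e)))) (at (x + t *\<^sub>R e))"
    using GDERIV_gradient [OF assms] by (simp add: gderiv_def)
  then have "((\<lambda>t. f (x + t *\<^sub>R e)) has_derivative
      (\<lambda>s. inner (s *\<^sub>R e) (gradient f (x + t *\<^sub>R e)))) (at t)"
    by (rule has_derivative_compose [rotated]) (auto intro!: derivative_eq_intros)
  then show ?thesis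
    by (rule has_derivative_imp_has_field_derivative) (simp add: inner_commute)
qed

lemma gradient_differentiable_along_line:
  fixes f :: "'a::euclidean_space \<Rightarrow> real"
  assumes "gradient f differentiable (at (x + t *\<^sub>R e))"
  shows "((\<lambda>t. inner (gradient f (x + t *\<^sub>R e)) e) has_real_derivative
    inner (hessian f (x + t *\<^sub>R e) e) e) (at t)"
proof -
  have h: "(gradient f has_derivative hessian f (x + t *\<^sub>R e)) (at (x + t *\<^sub>R e))"
    using assms unfolding hessian_def by (simp add: frechet_derivative_works)
  then have "((\<lambda>t. gradient f (x + t *\<^sub>R e)) has_derivative
      (\<lambda>s. hessian f (x + t *\<^sub>R e) (s *\<^sub>R e))) (at t)"
    by (rule has_derivative_compose [rotated]) (auto intro!: derivative_eq_intros)
  then have "((\<lambda>t. inner (gradient f (x + t *\<^sub>R e)) e) has_derivative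
      (\<lambda>s. inner (hessian f (x + t *\<^sub>R e) (s *\<^sub>R e)) e)) (at t)"
    by (rule has_derivative_inner_left)
  then show ?thesis
    by (rule has_derivative_imp_has_field_derivative)
      (simp add: linear_scale [OF has_derivative_linear [OF h]])
qed

text \<open>The matrices fixed by \<open>P\<close> form a linear space of rank at most
  \<open>2 * r\<close>, so the whole segment and its direction satisfy the rank restrictions.
  Integration along it uses the Lipschitz bound above and the Hessian below.\<close>

lemma restricted_quadratic_bounds:
  fixes f :: "real^'n^'n \<Rightarrow> real"
  assumes f: "twice_differentiable f" "restricted_smooth_strongly_convex r L \<mu> f"
    and P: "P ** X = X" "P ** X' = X'" "rank P \<le> 2 * r"
  shows "f X' \<le> f X + inner (gradient f X) (X' - X) + L / 2 * (norm (X' - X))\<^sup>2"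
    and "f X + inner (gradient f X) (X' - X) + \<mu> / 2 * (norm (X' - X))\<^sup>2 \<le> f X'"
proof -
  define E where "E = X' - X"
  have rank: "rank W \<le> 2 * r" if "P ** W = W" for W :: "real^'n^'n"
    using rank_mul_le_left [of P W] that P(3) by simp
  have rE: "rank E \<le> 2 * r" and rX: "rank X \<le> 2 * r"
    using P by (auto intro!: rank simp: E_def matrix_mult_diff_distrib)
  have rt: "rank (X + t *\<^sub>R E) \<le> 2 * r" for t
    using P by (auto intro!: rank simp: E_def matrix_mult_diff_distrib matrix_mult_add_distrib
        scaleR_matrix_mult)
  define q where "q t = f (X + t *\<^sub>R E)" for t
  define q' where "q' t = inner (gradient f (X + t *\<^sub>R E)) E" for t
  have q: "(q has_real_derivative q' t) (at t)" for t
    unfolding q_def q'_def using f(1)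
    by (intro differentiable_along_line) (auto simp: twice_differentiable_def)
  have q': "(q' has_real_derivative inner (hessian f (X + t *\<^sub>R E) E) E) (at t)" for t
    unfolding q'_def using f(1)
    by (intro gradient_differentiable_along_line) (auto simp: twice_differentiable_def)
  have q01: "q 0 = f X" "q 1 = f X'" "q' 0 = inner (gradient f X) E"
    by (simp_all add: q_def q'_def E_def)
  have "q 1 \<le> q 0 + q' 0 + L * (norm E)\<^sup>2 / 2"
  proof (rule quadratic_upper_bound_unit_interval [OF q])
    fix t :: real assume t: "0 \<le> t"
    have "q' t - q' 0 = inner (gradient f (X + t *\<^sub>R E) - gradient f X) E"
      by (simp add: q'_def inner_diff_left)
    also have "\<dots> \<le> norm (gradient f (X + t *\<^sub>R E) - gradient f X) * norm E"
      by (rule norm_cauchy_schwarz)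
    also have "norm (gradient f (X + t *\<^sub>R E) - gradient f X) \<le> L * norm (X + t *\<^sub>R E - X)"
      using f(2) rt [of t] rX unfolding restricted_smooth_strongly_convex_def by blast
    finally show "q' t \<le> q' 0 + L * (norm E)\<^sup>2 * t"
      using t by (simp add: mult_right_mono power2_eq_square mult_ac)
  qed
  then show "f X' \<le> f X + inner (gradient f X) (X' - X) + L / 2 * (norm (X' - X))\<^sup>2"
    by (simp add: q01 E_def)
  have "- q 1 \<le> - q 0 + - q' 0 + - (\<mu> * (norm E)\<^sup>2) / 2"
  proof (rule quadratic_upper_bound_unit_interval [where q' = "\<lambda>t. - q' t"])
    show "((\<lambda>t. - q t) has_real_derivative - q' t) (at t)" for t
      by (intro DERIV_minus q)
    fix t :: real assume t: "0 \<le> t"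
    have "q' 0 - \<mu> * (norm E)\<^sup>2 * 0 \<le> q' t - \<mu> * (norm E)\<^sup>2 * t"
    proof (rule DERIV_nonneg_imp_nondecreasing [OF t])
      fix s
      have "((\<lambda>t. q' t - \<mu> * (norm E)\<^sup>2 * t) has_real_derivative
          inner (hessian f (X + s *\<^sub>R E) E) E - \<mu> * (norm E)\<^sup>2) (at s)"
        by (auto intro!: derivative_eq_intros q')
      moreover have "0 \<le> inner (hessian f (X + s *\<^sub>R E) E) E - \<mu> * (norm E)\<^sup>2"
        using f(2) rt [of s] rE unfolding restricted_smooth_strongly_convex_def by simp
      ultimately show "\<exists>y. ((\<lambda>t. q' t - \<mu> * (norm E)\<^sup>2 * t) has_real_derivative y) (at s) \<and> 0 \<le> y"
        by blast
    qed
    then show "- q' t \<le> - q' 0 + - (\<mu> * (norm E)\<^sup>2) * t" by simp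
  qed
  then show "f X + inner (gradient f X) (X' - X) + \<mu> / 2 * (norm (X' - X))\<^sup>2 \<le> f X'"
    by (simp add: q01 E_def)
qed

section \<open>Co-coercivity and the error of a projected gradient\<close>

text \<open>The Baillon-Haddad argument inside \<open>S\<close>: compare the lower bound from
  \<open>x\<close> with the upper bound from \<open>y\<close> at a point reached from
  \<open>y\<close> by a gradient step, then add the same estimate with \<open>x\<close> and
  \<open>y\<close> exchanged.\<close>

lemma cocoercive_on_subspace:
  fixes \<phi> :: "'a::real_inner \<Rightarrow> real"
  assumes S: "subspace S" "\<And>x. x \<in> S \<Longrightarrow> g x \<in> S"
    and lower: "\<And>x y. x \<in> S \<Longrightarrow> y \<in> S \<Longrightarrow> \<phi> x + inner (g x) (y - x) \<le> \<phi> y"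
    and upper: "\<And>x y. x \<in> S \<Longrightarrow> y \<in> S \<Longrightarrow>
      \<phi> y \<le> \<phi> x + inner (g x) (y - x) + K / 2 * (norm (y - x))\<^sup>2"
    and xy: "x \<in> S" "y \<in> S" and K: "0 \<le> K"
  shows "(norm (g x - g y))\<^sup>2 \<le> K * inner (g x - g y) (x - y)"
proof -
  have half: "\<phi> x + inner (g x) (y - x) + (t - K * t\<^sup>2 / 2) * (norm (g x - g y))\<^sup>2 \<le> \<phi> y"
    if xy: "x \<in> S" "y \<in> S" for x y t
  proof -
    define D where "D = g y - g x"
    define z where "z = y - t *\<^sub>R D"
    have z: "z \<in> S"
      unfolding z_def D_def using xy S by (intro subspace_diff subspace_scale) auto
    have "\<phi> x + inner (g x) (z - x) \<le> \<phi> y + inner (g y) (z - y) + K / 2 * (norm (z - y))\<^sup>2"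
      using lower [OF xy(1) z] upper [OF xy(2) z] by simp
    moreover have "inner (g x) (z - x) = inner (g x) (y - x) - t * inner (g x) D"
      by (simp add: z_def inner_diff_right)
    moreover have "inner (g y) (z - y) = - t * inner (g y) D"
      by (simp add: z_def)
    moreover have "(norm (z - y))\<^sup>2 = t\<^sup>2 * (norm D)\<^sup>2"
      by (simp add: z_def power_mult_distrib)
    moreover have "inner (g y) D - inner (g x) D = (norm D)\<^sup>2"
      by (simp add: D_def power2_norm_eq_inner inner_diff_left)
    then have "t * inner (g y) D - t * inner (g x) D = t * (norm D)\<^sup>2"
      by (metis right_diff_distrib)
    moreover have "norm (g x - g y) = norm D" by (simp add: D_def norm_minus_commute)
    ultimately show ?thesis by (simp add: algebra_simps)
  qed
  define n where "n = (norm (g x - g y))\<^sup>2"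
  define c where "c = inner (g x - g y) (x - y)"
  have *: "(2 * t - K * t\<^sup>2) * n \<le> c" for t
    using half [OF xy, of t] half [OF xy(2,1), of t]
    by (simp add: n_def c_def norm_minus_commute inner_diff_left inner_diff_right algebra_simps)
  have "n \<le> K * c"
  \<comment> \<open>\<open>K = 0\<close> occurs for \<open>L = \<mu>\<close>. Then the bound is
    linear in \<open>t\<close> and fails for large \<open>t\<close> unless \<open>n = 0\<close>;
    otherwise \<open>t = 1 / K\<close> is optimal.\<close>
  proof (cases "K = 0")
    case True
    have "n = 0"
    proof (rule ccontr)
      assume "n \<noteq> 0"
      then show False using * [of "(c + 1) / (2 * n)"] True by simp
    qed
    then show ?thesis using True by simp
  next
    case False
    then have "n / K \<le> c" using * [of "1 / K"] by (simp add: power2_eq_square)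
    then show ?thesis using False K by (simp add: field_simps)
  qed
  then show ?thesis by (simp add: n_def c_def)
qed

text \<open>On the space fixed by \<open>P\<close>, subtracting \<open>\<mu> / 2\<close> times the
  squared norm from \<open>f\<close> leaves a convex function with smoothness constant
  \<open>L - \<mu>\<close>, whose gradient there is \<open>g\<close>. Its co-coercivity is
  equivalent to the claim.\<close>

lemma restricted_gradient_step_error:
  fixes f :: "real^'n^'n \<Rightarrow> real"
  assumes f: "twice_differentiable f" "restricted_smooth_strongly_convex r L \<mu> f"
    and L: "0 < \<mu>" "\<mu> \<le> L" and Xs: "gradient f Xs = 0"
    and P: "orthogonal_projector P" "P ** X = X" "P ** Xs = Xs" "rank P \<le> 2 * r"
  shows "norm (P ** ((2 / (L + \<mu>)) *\<^sub>R gradient f X) - (X - Xs))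
    \<le> (L - \<mu>) / (L + \<mu>) * norm (X - Xs)"
proof -
  define S where "S = {A :: real^'n^'n. P ** A = A}"
  define g where "g A = P ** gradient f A - \<mu> *\<^sub>R A" for A
  have PP: "P ** (P ** A) = P ** A" for A :: "real^'n^'n"
    using P(1) by (simp add: orthogonal_projector_def matrix_mul_assoc)
  have S: "subspace S"
    by (simp add: subspace_def S_def matrix_mult_add_distrib scaleR_matrix_mult)
  have g: "g A \<in> S" if "A \<in> S" for A
    using that by (simp add: S_def g_def matrix_mult_diff_distrib PP scaleR_matrix_mult)
  have ginner: "inner (g A) (B - A) = inner (gradient f A) (B - A) - \<mu> * inner A (B - A)"
    if "A \<in> S" "B \<in> S" for A B
  proof -
    have "inner (P ** gradient f A) (B - A) = inner (gradient f A) (P ** (B - A))"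
      using P(1) by (simp add: inner_matrix_mult_left orthogonal_projector_def)
    also have "P ** (B - A) = B - A"
      using that by (simp add: S_def matrix_mult_diff_distrib)
    finally show ?thesis by (simp add: g_def inner_diff_left)
  qed
  have norms: "(norm B)\<^sup>2 = (norm A)\<^sup>2 + 2 * inner A (B - A) + (norm (B - A))\<^sup>2"
    for A B :: "real^'n^'n"
    by (simp add: power2_norm_eq_inner inner_diff_left inner_diff_right inner_commute)
  define \<Gamma> where "\<Gamma> = P ** gradient f X"
  define \<Delta> where "\<Delta> = X - Xs"
  have "(norm (g X - g Xs))\<^sup>2 \<le> (L - \<mu>) * inner (g X - g Xs) (X - Xs)"
  proof (rule cocoercive_on_subspace [where \<phi> = "\<lambda>A. f A - \<mu> / 2 * (norm A)\<^sup>2", OF S g])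
    fix A B assume AB: "A \<in> S" "B \<in> S"
    then have PAB: "P ** A = A" "P ** B = B" by (simp_all add: S_def)
    note bounds = restricted_quadratic_bounds [OF f PAB P(4)]
    have nB: "\<mu> / 2 * (norm B)\<^sup>2 = \<mu> / 2 * (norm A)\<^sup>2 + \<mu> * inner A (B - A) + \<mu> / 2 * (norm (B - A))\<^sup>2"
      by (subst norms [of B A]) (simp add: algebra_simps)
    show "f A - \<mu> / 2 * (norm A)\<^sup>2 + inner (g A) (B - A) \<le> f B - \<mu> / 2 * (norm B)\<^sup>2"
      using bounds(2) nB ginner [OF AB] by linarith
    have "(L - \<mu>) / 2 * (norm (B - A))\<^sup>2 = L / 2 * (norm (B - A))\<^sup>2 - \<mu> / 2 * (norm (B - A))\<^sup>2"
      by (simp add: algebra_simps diff_divide_distrib)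
    then show "f B - \<mu> / 2 * (norm B)\<^sup>2 \<le> f A - \<mu> / 2 * (norm A)\<^sup>2 + inner (g A) (B - A)
        + (L - \<mu>) / 2 * (norm (B - A))\<^sup>2"
      using bounds(1) nB ginner [OF AB] by linarith
  qed (use P L in \<open>auto simp: S_def\<close>)
  also have "g X - g Xs = \<Gamma> - \<mu> *\<^sub>R \<Delta>"
    by (simp add: g_def \<Gamma>_def \<Delta>_def Xs algebra_simps)
  finally have "(norm (\<Gamma> - \<mu> *\<^sub>R \<Delta>))\<^sup>2 \<le> (L - \<mu>) * inner (\<Gamma> - \<mu> *\<^sub>R \<Delta>) \<Delta>"
    by (simp add: \<Delta>_def)
  \<comment> \<open>The square is completed with
    \<open>4 * L * \<mu> = (L + \<mu>)\<^sup>2 - (L - \<mu>)\<^sup>2\<close>.\<close>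
  then have "4 * (norm \<Gamma>)\<^sup>2 - 4 * (L + \<mu>) * inner \<Gamma> \<Delta> + (L + \<mu>)\<^sup>2 * (norm \<Delta>)\<^sup>2
      \<le> (L - \<mu>)\<^sup>2 * (norm \<Delta>)\<^sup>2"
    unfolding power2_norm_eq_inner
    by (simp add: inner_diff_left inner_diff_right inner_commute power2_eq_square algebra_simps)
  moreover have "(norm (2 *\<^sub>R \<Gamma> - (L + \<mu>) *\<^sub>R \<Delta>))\<^sup>2
      = 4 * (norm \<Gamma>)\<^sup>2 - 4 * (L + \<mu>) * inner \<Gamma> \<Delta> + (L + \<mu>)\<^sup>2 * (norm \<Delta>)\<^sup>2"
    unfolding power2_norm_eq_inner
    by (simp add: inner_diff_left inner_diff_right inner_commute power2_eq_square algebra_simps)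
  ultimately have "(norm (2 *\<^sub>R \<Gamma> - (L + \<mu>) *\<^sub>R \<Delta>))\<^sup>2 \<le> ((L - \<mu>) * norm \<Delta>)\<^sup>2"
    by (simp add: power_mult_distrib)
  then have le: "norm (2 *\<^sub>R \<Gamma> - (L + \<mu>) *\<^sub>R \<Delta>) \<le> (L - \<mu>) * norm \<Delta>"
    by (rule power2_le_imp_le) (simp add: L)
  have "P ** ((2 / (L + \<mu>)) *\<^sub>R gradient f X) - \<Delta> = (1 / (L + \<mu>)) *\<^sub>R (2 *\<^sub>R \<Gamma> - (L + \<mu>) *\<^sub>R \<Delta>)"
    using L by (simp add: \<Gamma>_def scaleR_matrix_mult scaleR_diff_right)
  then have "norm (P ** ((2 / (L + \<mu>)) *\<^sub>R gradient f X) - \<Delta>)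
      = (1 / (L + \<mu>)) * norm (2 *\<^sub>R \<Gamma> - (L + \<mu>) *\<^sub>R \<Delta>)"
    using L by simp
  also have "\<dots> \<le> (1 / (L + \<mu>)) * ((L - \<mu>) * norm \<Delta>)"
    using L by (intro mult_left_mono le) simp
  finally show ?thesis by (simp add: \<Delta>_def)
qed

section \<open>Function values near the minimizer and the decrease in one step\<close>

lemma gradient_eq_0_at_minimizer:
  fixes f :: "'a::euclidean_space \<Rightarrow> real"
  assumes "f differentiable (at x)" "is_arg_min f (\<lambda>_. True) x"
  shows "gradient f x = 0"
proof -
  have "(\<lambda>h. inner h (gradient f x)) = (\<lambda>h. 0)"
  proof (rule differential_zero_maxmin [of x UNIV f])
    show "(f has_derivative (\<lambda>h. inner h (gradient f x))) (at x)"
      using GDERIV_gradient [OF assms(1)] by (simp add: gderiv_def)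
    show "(\<forall>y\<in>UNIV. f y \<le> f x) \<or> (\<forall>y\<in>UNIV. f x \<le> f y)"
      using assms(2) by (auto simp: is_arg_min_def not_less)
  qed auto
  then show ?thesis by (metis inner_eq_zero_iff)
qed

lemma common_projector_rank_le:
  fixes A B :: "real^'n^'n"
  assumes "rank A \<le> r" "rank B \<le> r"
  obtains P where "P ** A = A" "P ** B = B" "rank P \<le> 2 * r"
proof -
  obtain P where "P ** A = A" "P ** B = B" "rank P \<le> rank A + rank B"
    using orthogonal_projector_onto_sum [of A B] by metis
  then show ?thesis using assms by (intro that [of P]) auto
qed

lemma suboptimality_bounds:
  fixes f :: "real^'n^'n \<Rightarrow> real"
  assumes "twice_differentiable f" "restricted_smooth_strongly_convex r L \<mu> f"
    and "gradient f Xs = 0" "rank X \<le> r" "rank Xs \<le> r"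
  shows "f X - f Xs \<le> L / 2 * (norm (X - Xs))\<^sup>2" "\<mu> / 2 * (norm (X - Xs))\<^sup>2 \<le> f X - f Xs"
proof -
  obtain P where "P ** Xs = Xs" "P ** X = X" "rank P \<le> 2 * r"
    using common_projector_rank_le assms(4,5) by metis
  from restricted_quadratic_bounds [OF assms(1,2) this]
  show "f X - f Xs \<le> L / 2 * (norm (X - Xs))\<^sup>2" "\<mu> / 2 * (norm (X - Xs))\<^sup>2 \<le> f X - f Xs"
    by (simp_all add: assms(3))
qed

lemma projgd_step_contraction:
  fixes f :: "real^'n^'n \<Rightarrow> real"
  assumes f: "twice_differentiable f" "restricted_smooth_strongly_convex r L \<mu> f"
    and L: "0 < \<mu>" "\<mu> \<le> L" and grad: "gradient f Xs = 0"
    and rX: "rank X \<le> r" and rXs: "rank Xs \<le> r"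
    and proj: "is_rank_projection r (X - \<eta> *\<^sub>R gradient f X) Z"
    and eta: "0 < \<eta>" "L * \<eta> \<le> 1" and h: "h = (L + \<mu>) * \<eta> / 2"
    and k: "0 < \<kappa>" "\<kappa> < 1 / 2" and m: "0 \<le> m"
    and m1: "(L - \<mu>) / (L + \<mu>) + (1 + sqrt 2) * m / h \<le> \<kappa>"
    and m2: "\<kappa> / (1 - \<kappa>\<^sup>2) + 2 * sqrt (real r) * m \<le> h"
  shows "f Z - f Xs \<le> (1 - (1 / (L * \<eta>) - 1) * m\<^sup>2) * (f X - f Xs)"
proof -
  define V where "V = (2 / (L + \<mu>)) *\<^sub>R gradient f X"
  define D where "D = Z - X"
  have hV: "h *\<^sub>R V = \<eta> *\<^sub>R gradient f X" using L by (simp add: h V_def)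
  have "m * norm (X - Xs) \<le> norm (Z - X)"
  proof (rule rank_projection_step_ge [OF rX rXs])
    show "is_rank_projection r (X - h *\<^sub>R V) Z" using proj by (simp add: hV)
    show "0 < h" using L eta by (simp add: h)
  qed (use k m1 m2 restricted_gradient_step_error [OF f L grad] in \<open>auto simp: V_def\<close>)
  then have far: "m\<^sup>2 * (norm (X - Xs))\<^sup>2 \<le> (norm D)\<^sup>2"
    using m by (simp add: D_def power_mono flip: power_mult_distrib)
  obtain P where P: "P ** X = X" "P ** Z = Z" "rank P \<le> 2 * r"
    using common_projector_rank_le rX rank_projection_rank_le [OF proj] by metis
  have dec: "f Z \<le> f X + inner (gradient f X) D + L / 2 * (norm D)\<^sup>2"
    using restricted_quadratic_bounds(1) [OF f P] by (simp add: D_def)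
  \<comment> \<open>\<open>X\<close> itself has rank at most \<open>r\<close> and competes in the
    projection.\<close>
  have "norm (\<eta> *\<^sub>R gradient f X + D) \<le> norm (\<eta> *\<^sub>R gradient f X)"
    using rank_projection_minimal [OF proj rX] norm_minus_cancel [of "\<eta> *\<^sub>R gradient f X + D"]
    by (simp add: D_def algebra_simps)
  then have "(norm (\<eta> *\<^sub>R gradient f X + D))\<^sup>2 \<le> (norm (\<eta> *\<^sub>R gradient f X))\<^sup>2"
    by (intro power_mono) auto
  then have "2 * \<eta> * inner (gradient f X) D + (norm D)\<^sup>2 \<le> 0"
    unfolding power2_norm_eq_inner by (simp add: inner_add_left inner_add_right inner_commute)
  then have "inner (gradient f X) D \<le> - (norm D)\<^sup>2 / (2 * \<eta>)"
    using eta(1) by (simp add: field_simps)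
  \<comment> \<open>Factoring out \<open>L / 2\<close> matches the smoothness bound on
    \<open>f X - f Xs\<close>, so the decrease can be measured in function values.\<close>
  moreover have "- (1 / (L * \<eta>) - 1) * (L / 2 * (norm D)\<^sup>2)
      = - (norm D)\<^sup>2 / (2 * \<eta>) + L / 2 * (norm D)\<^sup>2"
    using L eta(1) by (simp add: field_simps)
  ultimately have "f Z - f X \<le> - (1 / (L * \<eta>) - 1) * (L / 2 * (norm D)\<^sup>2)"
    using dec by linarith
  also have "\<dots> \<le> - (1 / (L * \<eta>) - 1) * (m\<^sup>2 * (f X - f Xs))"
  proof -
    have "m\<^sup>2 * (f X - f Xs) \<le> m\<^sup>2 * (L / 2 * (norm (X - Xs))\<^sup>2)"
      using suboptimality_bounds(1) [OF f grad rX rXs] by (intro mult_left_mono) auto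
    also have "\<dots> = L / 2 * (m\<^sup>2 * (norm (X - Xs))\<^sup>2)" by simp
    also have "\<dots> \<le> L / 2 * (norm D)\<^sup>2" using L far by (intro mult_left_mono) auto
    finally have "m\<^sup>2 * (f X - f Xs) \<le> L / 2 * (norm D)\<^sup>2" .
    moreover have "1 \<le> 1 / (L * \<eta>)" using L eta by simp
    ultimately show ?thesis by (intro mult_left_mono_neg) auto
  qed
  finally have "f Z - f X \<le> - (1 / (L * \<eta>) - 1) * (m\<^sup>2 * (f X - f Xs))" .
  moreover have "(1 - a * b) * c = c + - a * (b * c)" for a b c :: real
    by (simp add: algebra_simps)
  note this [of "1 / (L * \<eta>) - 1" "m\<^sup>2" "f X - f Xs"]
  ultimately show ?thesis by linarith
qed

section \<open>Choice of the constants and linear convergence\<close>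

text \<open>Since \<open>\<kappa> + \<kappa>\<^sub>0 < 1\<close>, the gap
  \<open>\<kappa> - \<kappa>\<^sub>0\<close> is at least the difference of squares
  \<open>2 * \<epsilon> * (1 - \<epsilon>)\<close>, hence at least
  \<open>17 / 10 * \<epsilon>\<close>; the entry \<open>2 * \<epsilon> * h / 3\<close> of
  \<open>m\<close> uses less than that. The last entry is the final inequality solved for
  \<open>m\<close>.\<close>

lemma contraction_margin:
  fixes \<epsilon> \<kappa> \<kappa>\<^sub>0 h m :: real
  assumes k: "0 \<le> \<kappa>\<^sub>0" "0 < \<epsilon>" "\<epsilon> < 1 / 2" "\<kappa> = sqrt (\<kappa>\<^sub>0\<^sup>2 + 2 * \<epsilon> - 2 * \<epsilon>\<^sup>2)" "\<kappa> < 1 / 2"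
    and h: "0 < h" "\<kappa> / (1 - \<kappa>\<^sup>2) < h" and r: "1 \<le> (r::nat)"
    and m: "m = min (h / 10) (min (2 * \<epsilon> * h / 3)
      (1 / (2 * sqrt (real r)) * (h - \<kappa> / (1 - \<kappa>\<^sup>2))))"
  shows "0 < \<kappa>" "0 < m" "\<kappa>\<^sub>0 + (1 + sqrt 2) * m / h \<le> \<kappa>"
    "\<kappa> / (1 - \<kappa>\<^sup>2) + 2 * sqrt (real r) * m \<le> h"
proof -
  have e2: "2 * \<epsilon> - 2 * \<epsilon>\<^sup>2 = 2 * (\<epsilon> * (1 - \<epsilon>))" by (simp add: power2_eq_square algebra_simps)
  have e: "0 < \<epsilon> * (1 - \<epsilon>)" using k by simp
  then have "\<kappa>\<^sub>0\<^sup>2 < \<kappa>\<^sub>0\<^sup>2 + 2 * \<epsilon> - 2 * \<epsilon>\<^sup>2" using e2 by linarith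
  then have "\<kappa>\<^sub>0 < \<kappa>" unfolding k(4) using k(1) by (intro real_less_rsqrt)
  then show \<kappa>0: "0 < \<kappa>" using k(1) by simp
  have ksq: "\<kappa>\<^sup>2 = \<kappa>\<^sub>0\<^sup>2 + 2 * (\<epsilon> * (1 - \<epsilon>))"
  proof -
    have "0 \<le> \<kappa>\<^sub>0\<^sup>2 + 2 * \<epsilon> - 2 * \<epsilon>\<^sup>2" using e2 e zero_le_power2 [of \<kappa>\<^sub>0] by linarith
    then show ?thesis unfolding k(4) using e2 by simp
  qed
  have "\<kappa>\<^sup>2 < (1 / 2)\<^sup>2" using k(5) \<kappa>0 by (intro power_strict_mono) auto
  then have e8: "\<epsilon> * (1 - \<epsilon>) < 1 / 8" using ksq by (simp add: power2_eq_square) (smt (verit) zero_le_square)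
  \<comment> \<open>\<open>\<epsilon> * (1 - \<epsilon>) < 1 / 8\<close> leaves two ranges for
    \<epsilon>; \<open>\<epsilon> < 1 / 2\<close> selects the lower one, whose end is about
    0.146.\<close>
  have e15: "\<epsilon> < 3 / 20"
  proof (rule ccontr)
    assume ge: "\<not> ?thesis"
    then have "0 \<le> (\<epsilon> - 3 / 20) * (1 / 2 - \<epsilon>)" using k(3) by simp
    moreover have "(\<epsilon> - 3 / 20) * (1 / 2 - \<epsilon>) = 13 / 20 * \<epsilon> - \<epsilon> * \<epsilon> - 3 / 40"
      by (simp add: field_simps)
    moreover have "\<epsilon> - \<epsilon> * \<epsilon> < 1 / 8" using e8 by (simp add: right_diff_distrib)
    ultimately show False using ge by linarith
  qed
  have "(\<kappa> - \<kappa>\<^sub>0) * (\<kappa> + \<kappa>\<^sub>0) = 2 * (\<epsilon> * (1 - \<epsilon>))"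
    using ksq by (simp add: power2_eq_square algebra_simps)
  moreover have "(\<kappa> - \<kappa>\<^sub>0) * (\<kappa> + \<kappa>\<^sub>0) \<le> (\<kappa> - \<kappa>\<^sub>0) * 1"
    using \<open>\<kappa>\<^sub>0 < \<kappa>\<close> k(5) by (intro mult_left_mono) auto
  ultimately have "2 * (\<epsilon> * (1 - \<epsilon>)) \<le> \<kappa> - \<kappa>\<^sub>0" by simp
  moreover have "\<epsilon> * (17 / 20) \<le> \<epsilon> * (1 - \<epsilon>)" using e15 k(2) by (intro mult_left_mono) auto
  ultimately have gap: "17 / 10 * \<epsilon> \<le> \<kappa> - \<kappa>\<^sub>0" by simp
  show "0 < m" using k h r by (simp add: m)
  have "sqrt 2 \<le> 142 / 100" by (rule real_le_lsqrt) (auto simp: power2_eq_square)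
  then have "(1 + sqrt 2) * (2 * \<epsilon> / 3) \<le> (242 / 100) * (2 * \<epsilon> / 3)"
    using k(2) by (intro mult_right_mono) auto
  moreover have "(1 + sqrt 2) * m / h \<le> (1 + sqrt 2) * (2 * \<epsilon> / 3)"
  proof -
    have "m / h \<le> 2 * \<epsilon> / 3" using h(1) by (simp add: m field_simps min_le_iff_disj)
    then have "(1 + sqrt 2) * (m / h) \<le> (1 + sqrt 2) * (2 * \<epsilon> / 3)"
      by (intro mult_left_mono) auto
    then show ?thesis by simp
  qed
  ultimately show "\<kappa>\<^sub>0 + (1 + sqrt 2) * m / h \<le> \<kappa>" using gap k(2) by linarith
  have sr: "0 < sqrt (real r)" using r by simp
  have "m \<le> 1 / (2 * sqrt (real r)) * (h - \<kappa> / (1 - \<kappa>\<^sup>2))" by (simp add: m)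
  then have "(2 * sqrt (real r)) * m
      \<le> (2 * sqrt (real r)) * (1 / (2 * sqrt (real r)) * (h - \<kappa> / (1 - \<kappa>\<^sup>2)))"
    using sr by (intro mult_left_mono) auto
  also have "\<dots> = h - \<kappa> / (1 - \<kappa>\<^sup>2)" using sr by simp
  finally show "\<kappa> / (1 - \<kappa>\<^sup>2) + 2 * sqrt (real r) * m \<le> h" by simp
qed

text \<open>Both hypotheses on \<open>\<kappa>\<^sub>0\<close> are strict, so by continuity they
  persist for the enlarged constant \<open>F e\<close> when \<open>e\<close> is small and
  positive.\<close>

lemma exists_contraction_margin:
  fixes \<kappa>\<^sub>0 h :: real
  assumes "0 \<le> \<kappa>\<^sub>0" "\<kappa>\<^sub>0 < 1 / 2" "\<kappa>\<^sub>0 / (1 - \<kappa>\<^sub>0\<^sup>2) < h" "1 \<le> (r::nat)"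
  obtains \<kappa> m where "0 < \<kappa>" "\<kappa> < 1 / 2" "0 < m" "\<kappa>\<^sub>0 + (1 + sqrt 2) * m / h \<le> \<kappa>"
    "\<kappa> / (1 - \<kappa>\<^sup>2) + 2 * sqrt (real r) * m \<le> h"
proof -
  define F where "F e = sqrt (\<kappa>\<^sub>0\<^sup>2 + 2 * e - 2 * e\<^sup>2)" for e
  have F0: "F 0 = \<kappa>\<^sub>0" using assms(1) by (simp add: F_def)
  have k1: "0 < 1 - \<kappa>\<^sub>0\<^sup>2" using assms by (simp add: abs_square_less_1)
  then have "0 \<le> \<kappa>\<^sub>0 / (1 - \<kappa>\<^sub>0\<^sup>2)" using assms(1) by simp
  then have h: "0 < h" using assms(3) by linarith
  have lim: "(F \<longlongrightarrow> \<kappa>\<^sub>0) (at_right 0)"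
    unfolding F0 [symmetric] unfolding F_def
    by (rule continuous_within_tendsto_compose') (auto intro!: tendsto_eq_intros)
  then have lim2: "((\<lambda>e. F e / (1 - (F e)\<^sup>2)) \<longlongrightarrow> \<kappa>\<^sub>0 / (1 - \<kappa>\<^sub>0\<^sup>2)) (at_right 0)"
    using k1 by (intro tendsto_intros) auto
  have "eventually (\<lambda>e. F e < 1 / 2 \<and> F e / (1 - (F e)\<^sup>2) < h \<and> e \<in> {0<..<1/2}) (at_right 0)"
    using order_tendstoD(2) [OF lim assms(2)] order_tendstoD(2) [OF lim2 assms(3)]
      eventually_at_right_real [of 0 "1/2"] by (simp add: eventually_conj)
  then obtain e where "F e < 1 / 2" "F e / (1 - (F e)\<^sup>2) < h" "0 < e" "e < 1 / 2"
    using eventually_happens' [OF trivial_limit_at_right_real] by fastforce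
  then show ?thesis
    using contraction_margin [OF assms(1) _ _ F_def _ h _ assms(4) refl, of e] that by blast
qed

text \<open>The square root appears because \<open>v\<close> controls the squared distance. The
  factor \<open>q\<close> may be negative, so the rate is built from \<open>max q 0\<close>.\<close>

lemma converges_linearly_if_contraction:
  fixes X :: "nat \<Rightarrow> 'a::real_normed_vector"
  assumes mu: "0 < \<mu>" and q: "q < 1"
    and step: "\<And>k. v (Suc k) \<le> q * v k"
    and lower: "\<And>k. \<mu> / 2 * (norm (X k - x))\<^sup>2 \<le> v k"
  shows "converges_linearly (sqrt (max q 0)) X x"
proof -
  have v0: "0 \<le> v k" for k
    using lower [of k] mu by (smt (verit) divide_pos_pos mult_nonneg_nonneg zero_le_power2)
  have vk: "v k \<le> v 0 * max q 0 ^ k" for k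
  proof (induction k)
    case (Suc k)
    have "v (Suc k) \<le> max q 0 * v k"
      using step [of k] mult_right_mono [OF max.cobounded1 [of q 0] v0 [of k]] by linarith
    also have "\<dots> \<le> max q 0 * (v 0 * max q 0 ^ k)"
      by (intro mult_left_mono Suc) simp
    finally show ?case by (simp add: mult_ac)
  qed simp
  have "norm (X k - x) \<le> sqrt (2 / \<mu> * v 0) * sqrt (max q 0) ^ k" for k
  proof -
    have "(norm (X k - x))\<^sup>2 \<le> 2 / \<mu> * v k"
      using lower [of k] mu by (simp add: field_simps)
    also have "\<dots> \<le> 2 / \<mu> * (v 0 * max q 0 ^ k)"
      using mu by (intro mult_left_mono vk) simp
    finally have "norm (X k - x) \<le> sqrt (2 / \<mu> * (v 0 * max q 0 ^ k))"
      by (rule real_le_rsqrt)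
    then show ?thesis by (simp add: real_sqrt_mult real_sqrt_power real_sqrt_divide)
  qed
  then show ?thesis
    using q unfolding converges_linearly_def by (intro conjI exI allI) auto
qed

theorem theorem2:
  fixes f :: "real^'n^'n \<Rightarrow> real"
    and Xs :: "real^'n^'n"
    and r :: nat
    and L \<mu> :: real
  assumes "1 \<le> r" and "r < CARD('n)"
    and "twice_differentiable f"
    and "0 < \<mu>" and "\<mu> \<le> L"
    and "restricted_smooth_strongly_convex r L \<mu> f"
    and "is_arg_min f (\<lambda>_. True) Xs" and "rank Xs \<le> r"
    and "L / \<mu> < 3"
  shows
    "(\<forall>\<eta>>0. (L\<^sup>2 - \<mu>\<^sup>2) / (2 * L * \<mu> * (L + \<mu>)) < \<eta> \<longrightarrow> \<eta> < 1 / L \<longrightarrow>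
        (\<exists>\<rho>. \<forall>X. projgd_iterates f r \<eta> X \<longrightarrow> converges_linearly \<rho> X Xs)) \<and>
     (\<forall>\<kappa>\<^sub>0 \<epsilon> \<kappa>h \<eta> \<eta>\<^sub>0 X.
        \<kappa>\<^sub>0 = (L - \<mu>) / (L + \<mu>) \<longrightarrow>
        0 < \<epsilon> \<longrightarrow> \<epsilon> < 1 / 2 \<longrightarrow>
        \<kappa>h = sqrt (\<kappa>\<^sub>0\<^sup>2 + 2 * \<epsilon> - 2 * \<epsilon>\<^sup>2) \<longrightarrow>
        0 < \<kappa>h \<longrightarrow> \<kappa>h < 1 / 2 \<longrightarrow>
        0 < \<eta> \<longrightarrow>
        \<eta>\<^sub>0 = (L + \<mu>) * \<eta> / 2 \<longrightarrow>
        1 / (1 / \<kappa>h - \<kappa>h) < \<eta>\<^sub>0 \<longrightarrow> \<eta>\<^sub>0 < 1 / (1 + \<kappa>\<^sub>0) \<longrightarrow>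
        projgd_iterates f r \<eta> X \<longrightarrow>
        (\<forall>k. f (X k) \<noteq> f Xs \<longrightarrow>
           (f (X (Suc k)) - f Xs) / (f (X k) - f Xs)
             \<le> 1 - (1 / ((1 + \<kappa>\<^sub>0) * \<eta>\<^sub>0) - 1) *
                   (min (\<eta>\<^sub>0 / 10)
                        (min (2 * \<epsilon> * \<eta>\<^sub>0 / 3)
                             (1 / (2 * sqrt (real r)) * (\<eta>\<^sub>0 - \<kappa>h / (1 - \<kappa>h\<^sup>2)))))\<^sup>2))"
proof -
  note f = assms(3,6) and L = assms(4,5) and rXs = assms(8)
  have grad: "gradient f Xs = 0"
    using assms(3,7) by (intro gradient_eq_0_at_minimizer) (auto simp: twice_differentiable_def)
  define k0 where "k0 = (L - \<mu>) / (L + \<mu>)"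
  have L0: "0 < L" using L by simp
  \<comment> \<open>\<open>k0 < 1 / 2\<close> is equivalent to \<open>L / \<mu> < 3\<close>.\<close>
  have k0: "0 \<le> k0" "k0 < 1 / 2"
    using L assms(9) by (simp_all add: k0_def field_simps)
  have sq: "1 - k0\<^sup>2 = 4 * L * \<mu> / (L + \<mu>)\<^sup>2"
  proof -
    have "1 - k0\<^sup>2 = ((L + \<mu>)\<^sup>2 - (L - \<mu>)\<^sup>2) / (L + \<mu>)\<^sup>2"
    proof -
      have "k0\<^sup>2 = (L - \<mu>)\<^sup>2 / (L + \<mu>)\<^sup>2" by (simp only: k0_def power_divide)
      then show ?thesis using L by (simp add: diff_divide_distrib)
    qed
    also have "(L + \<mu>)\<^sup>2 - (L - \<mu>)\<^sup>2 = 4 * L * \<mu>" by (simp add: power2_eq_square algebra_simps)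
    finally show ?thesis .
  qed
  have rank: "rank (X k) \<le> r" if "projgd_iterates f r \<eta> X" for X \<eta> k
    using that rank_projection_rank_le unfolding projgd_iterates_def by (cases k) auto
  have step: "f (X (Suc k)) - f Xs \<le> (1 - (1 / (L * \<eta>) - 1) * m\<^sup>2) * (f (X k) - f Xs)"
    if "projgd_iterates f r \<eta> X" "0 < \<eta>" "L * \<eta> \<le> 1" "h = (L + \<mu>) * \<eta> / 2" "0 < \<kappa>" "\<kappa> < 1 / 2" "0 < m"
      "k0 + (1 + sqrt 2) * m / h \<le> \<kappa>" "\<kappa> / (1 - \<kappa>\<^sup>2) + 2 * sqrt (real r) * m \<le> h"
    for X \<eta> h \<kappa> m k
  proof (rule projgd_step_contraction [OF f L grad rank [OF that(1)] rXs _ that(2-6)])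
    show "is_rank_projection r (X k - \<eta> *\<^sub>R gradient f (X k)) (X (Suc k))"
      using that(1) by (simp add: projgd_iterates_def)
  qed (use that in \<open>auto simp: k0_def\<close>)
  show ?thesis
  proof (intro conjI allI impI)
    fix \<eta> :: real
    assume eta: "0 < \<eta>" "(L\<^sup>2 - \<mu>\<^sup>2) / (2 * L * \<mu> * (L + \<mu>)) < \<eta>" "\<eta> < 1 / L"
    define h where "h = (L + \<mu>) * \<eta> / 2"
    have L\<eta>: "L * \<eta> < 1" using eta(3) L0 by (simp add: field_simps)
    \<comment> \<open>The lower bound on \<eta> in part (a) is the condition
      \<open>k0 / (1 - k0\<^sup>2) < h\<close> in other variables.\<close>
    have "k0 / (1 - k0\<^sup>2) = (L + \<mu>) / 2 * ((L\<^sup>2 - \<mu>\<^sup>2) / (2 * L * \<mu> * (L + \<mu>)))"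
    proof -
      have "L + \<mu> \<noteq> 0" using L by simp
      then have "k0 / (1 - k0\<^sup>2) = (L - \<mu>) * (L + \<mu>) / (4 * L * \<mu>)"
        unfolding sq by (simp add: k0_def power2_eq_square)
      moreover have "(L + \<mu>) / 2 * ((L\<^sup>2 - \<mu>\<^sup>2) / (2 * L * \<mu> * (L + \<mu>))) = (L\<^sup>2 - \<mu>\<^sup>2) / (4 * L * \<mu>)"
        using \<open>L + \<mu> \<noteq> 0\<close> by simp
      moreover have "(L - \<mu>) * (L + \<mu>) = L\<^sup>2 - \<mu>\<^sup>2" by (simp add: power2_eq_square algebra_simps)
      ultimately show ?thesis by simp
    qed
    also have "\<dots> < (L + \<mu>) / 2 * \<eta>"
      using L by (intro mult_strict_left_mono eta) simp
    finally have "k0 / (1 - k0\<^sup>2) < h" by (simp add: h_def)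
    then obtain \<kappa> m where km: "0 < \<kappa>" "\<kappa> < 1 / 2" "0 < m" "k0 + (1 + sqrt 2) * m / h \<le> \<kappa>"
      "\<kappa> / (1 - \<kappa>\<^sup>2) + 2 * sqrt (real r) * m \<le> h"
      using exists_contraction_margin k0 assms(1) by metis
    \<comment> \<open>\<open>q\<close> is fixed before any run, so one rate serves all
      initializations and all ways of breaking ties.\<close>
    define q where "q = 1 - (1 / (L * \<eta>) - 1) * m\<^sup>2"
    have "1 < 1 / (L * \<eta>)" using L\<eta> L0 eta(1) by simp
    then have q: "q < 1" using km(3) by (simp add: q_def)
    have "converges_linearly (sqrt (max q 0)) X Xs" if X: "projgd_iterates f r \<eta> X" for X
    proof (rule converges_linearly_if_contraction [OF L(1) q])
      show "f (X (Suc k)) - f Xs \<le> q * (f (X k) - f Xs)" for k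
        unfolding q_def using L\<eta> by (intro step [OF X eta(1) _ h_def km]) simp
      show "\<mu> / 2 * (norm (X k - Xs))\<^sup>2 \<le> f (X k) - f Xs" for k
        by (rule suboptimality_bounds(2) [OF f grad rank [OF X] rXs])
    qed
    then show "\<exists>\<rho>. \<forall>X. projgd_iterates f r \<eta> X \<longrightarrow> converges_linearly \<rho> X Xs" by blast
  next
    fix \<kappa>\<^sub>0 \<epsilon> \<kappa>h \<eta> \<eta>\<^sub>0 :: real and X :: "nat \<Rightarrow> real^'n^'n" and k
    assume kap: "\<kappa>\<^sub>0 = (L - \<mu>) / (L + \<mu>)" and eps: "0 < \<epsilon>" "\<epsilon> < 1 / 2"
      and kh: "\<kappa>h = sqrt (\<kappa>\<^sub>0\<^sup>2 + 2 * \<epsilon> - 2 * \<epsilon>\<^sup>2)" "0 < \<kappa>h" "\<kappa>h < 1 / 2"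
      and eta: "0 < \<eta>" "\<eta>\<^sub>0 = (L + \<mu>) * \<eta> / 2"
      and eta0: "1 / (1 / \<kappa>h - \<kappa>h) < \<eta>\<^sub>0" "\<eta>\<^sub>0 < 1 / (1 + \<kappa>\<^sub>0)"
      and X: "projgd_iterates f r \<eta> X" and neq: "f (X k) \<noteq> f Xs"
    let ?m = "min (\<eta>\<^sub>0 / 10) (min (2 * \<epsilon> * \<eta>\<^sub>0 / 3)
      (1 / (2 * sqrt (real r)) * (\<eta>\<^sub>0 - \<kappa>h / (1 - \<kappa>h\<^sup>2))))"
    have kk: "\<kappa>\<^sub>0 = k0" by (simp add: kap k0_def)
    have "1 / (1 / \<kappa>h - \<kappa>h) = \<kappa>h / (1 - \<kappa>h\<^sup>2)"
    proof -
      have "1 / \<kappa>h - \<kappa>h = (1 - \<kappa>h\<^sup>2) / \<kappa>h" using kh(2) by (simp add: field_simps power2_eq_square)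
      then show ?thesis by simp
    qed
    then have theta: "\<kappa>h / (1 - \<kappa>h\<^sup>2) < \<eta>\<^sub>0" using eta0(1) by simp
    have "0 < \<eta>\<^sub>0" using eta(1) L unfolding eta(2) by simp
    note margin = contraction_margin [OF k0(1) eps kh(1) [unfolded kk] kh(3) \<open>0 < \<eta>\<^sub>0\<close> theta assms(1) refl]
    \<comment> \<open>Translates the upper bound on \<open>\<eta>\<^sub>0\<close> into
      \<open>L * \<eta> < 1\<close> and the prefactor of part (b) into that of the one-step
      estimate.\<close>
    have "(1 + k0) * \<eta>\<^sub>0 = L * \<eta>"
    proof -
      have "1 + k0 = 2 * L / (L + \<mu>)" using L by (simp add: k0_def field_simps)
      then show ?thesis using L by (simp add: eta(2))
    qed
    moreover have "(1 + k0) * \<eta>\<^sub>0 < 1" using eta0(2) k0(1) kk by (simp add: field_simps)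
    ultimately have L\<eta>: "L * \<eta> = (1 + \<kappa>\<^sub>0) * \<eta>\<^sub>0" "L * \<eta> \<le> 1" by (simp_all add: kk)
    have "\<not> f (X k) < f Xs"
      using assms(7) by (simp add: is_arg_min_def)
    then have "0 < f (X k) - f Xs" using neq by simp
    moreover have "f (X (Suc k)) - f Xs \<le> (1 - (1 / ((1 + \<kappa>\<^sub>0) * \<eta>\<^sub>0) - 1) * ?m\<^sup>2) * (f (X k) - f Xs)"
      using step [OF X eta(1) L\<eta>(2) eta(2) kh(2,3) margin(2-4)] unfolding L\<eta>(1) .
    ultimately show "(f (X (Suc k)) - f Xs) / (f (X k) - f Xs)
        \<le> 1 - (1 / ((1 + \<kappa>\<^sub>0) * \<eta>\<^sub>0) - 1) * ?m\<^sup>2"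
      by (simp add: pos_divide_le_eq)
  qed
qed

end
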